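(* Let $D$ be a domain in $\mathbb{C}$ with finite Euclidean area, and let $\gamma(t)$, $t\geqslant 0$, be a Euclidean ray in $D$. Then the Euclidean and hyperbolic lengths $\mathcal{E}(t)$ and $\mathcal{H}(t)$, respectively, of the segment $[\gamma(0),\gamma(t)]$ satisfy $$\mathcal{E}(t)=o\big(\mathcal{H}(t)^{1/2}\big)\qquad\text{as } t\to+\infty .$$
   Context: A Euclidean ray is an infinite half-line $\gamma(t)=a+te^{i\varphi}$, $t\geqslant 0$ (with $a\in\mathbb{C}$, $\varphi\in\mathbb{R}$), all of whose points lie in $D$. The domain $D$ need not be simply connected. The hyperbolic metric $\lambda_D(w)|dw|$ of $D$ is defined by $\lambda_D(\pi(z))|\pi'(z)|=\lambda_{\mathbb{D}}(z)=2/(1-|z|^2)$, where $\pi:\mathbb{D}\to D$ is any holomorphic universal covering map from the unit disc $\mathbb{D}$; the hyperbolic length of a curve $\sigma$ in $D$ is $\int_\sigma\lambda_D(w)\,|dw|$. *)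

theory Defs
  imports "HOL-Complex_Analysis.Complex_Analysis" "HOL-Library.Landau_Symbols"
begin

text \<open>
  As the unit disc is simply connected, every holomorphic covering map defined on it
  is a universal covering map.
\<close>

definition holomorphic_universal_covering :: "(complex \<Rightarrow> complex) \<Rightarrow> complex set \<Rightarrow> bool" where
  "holomorphic_universal_covering \<pi> D \<longleftrightarrow>
     \<pi> holomorphic_on ball 0 1 \<and> covering_space (ball 0 1) \<pi> D"

text \<open>
  For the domains that possess a holomorphic universal covering by the disc, the value
  below exists and depends neither on the covering nor on the point \<open>z\<close> over \<open>w\<close>. The
  definition is only meaningful for \<open>w \<in> D\<close> with \<open>D\<close> such a domain; it is unspecified
  otherwise. The normalisation \<open>2 / (1 - |z|\<^sup>2)\<close> gives curvature \<open>-1\<close>.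
\<close>

definition hyperbolic_density :: "complex set \<Rightarrow> complex \<Rightarrow> real" where
  "hyperbolic_density D w =
     (THE l. \<forall>\<pi> z. holomorphic_universal_covering \<pi> D \<longrightarrow> z \<in> ball 0 1 \<longrightarrow> \<pi> z = w \<longrightarrow>
        l * norm (deriv \<pi> z) = 2 / (1 - (norm z)\<^sup>2))"

text \<open>Curves are parametrised by \<open>[0, 1]\<close>, as in the library's path theories.\<close>

definition euclidean_length :: "(real \<Rightarrow> complex) \<Rightarrow> real" where
  "euclidean_length \<sigma> =
     integral {0..1} (\<lambda>s. norm (vector_derivative \<sigma> (at s within {0..1})))"

definition hyperbolic_length :: "complex set \<Rightarrow> (real \<Rightarrow> complex) \<Rightarrow> real" where
  "hyperbolic_length D \<sigma> =
     integral {0..1} (\<lambda>s. hyperbolic_density D (\<sigma> s) *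
       norm (vector_derivative \<sigma> (at s within {0..1})))"

text \<open>Only the values \<open>\<gamma> t\<close> with \<open>t \<ge> 0\<close> matter.\<close>

definition euclidean_ray_in :: "(real \<Rightarrow> complex) \<Rightarrow> complex set \<Rightarrow> bool" where
  "euclidean_ray_in \<gamma> D \<longleftrightarrow>
     (\<exists>a \<phi>. \<forall>t\<ge>0. \<gamma> t = a + of_real t * exp (\<i> * of_real \<phi>)) \<and> (\<forall>t\<ge>0. \<gamma> t \<in> D)"

end

theory Submission
  imports Defs
begin

text \<open>
  Write \<open>\<lambda>\<close> for the hyperbolic density of \<open>D\<close>. By the Cauchy-Schwarz inequality
  \<open>(t - T)\<^sup>2 \<le> \<integral> \<lambda> * \<integral> 1 / \<lambda>\<close> on the part of the ray between the parameters \<open>T\<close> and \<open>t\<close>, so it suffices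
  that \<open>1 / \<lambda>\<close> is integrable along the ray. The Cauchy transform of a piece of the complement of \<open>D\<close> in
  a cone with vertex \<open>w\<close> and axis orthogonal to the ray yields a bounded holomorphic function on \<open>D\<close> with
  large derivative at \<open>w\<close>; this bounds \<open>1 / \<lambda> w\<close> by a constant times \<open>\<integral> Im (z - w) / \<bar>z - w\<bar>\<^sup>2\<close>, taken over
  the part of \<open>D\<close> in that cone (for a horizontal ray). Integrating over \<open>w\<close> in the ray, Fubini's theorem
  leaves at most twice the area of the part of \<open>D\<close> that the cones meet, and this tends to \<open>0\<close> as \<open>T\<close> grows.

  A holomorphic covering of \<open>D\<close> by the disc has to be constructed for \<open>\<lambda>\<close> to be meaningful. For bounded
  pieces of \<open>D\<close>, Koebe's square root trick gives maps that have all inverse branches and are defined on nearly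
  the whole disc. The bounded functions above make maps from a disc into \<open>D\<close> a normal family, and a limit of
  these maps is a covering.
\<close>

section \<open>Coverings of plane domains by the disc\<close>

text \<open>The cone is dictated by the integration along the ray. The plain bound
  \<open>1 / |x - w|\<close> for the Cauchy kernel would fail: its integral over \<open>w\<close> in
  a whole ray diverges logarithmically. In the cone, the imaginary part of the rotated kernel is
  nonnegative, so nothing cancels, and its integral over all vertices on the ray is at most 2 for
  each \<open>x\<close>. A cone with vertex beyond parameter \<open>T\<close> also stays in a
  half-plane, so only a tail of \<open>D\<close> enters; its area is small, which gives o instead of
  O.

  The complement of \<open>D\<close> has infinite area, so its part in the cone must be cut off at a
  radius, which is fixed by comparison with the share of the cone that \<open>D\<close> fills.

  A single derivative estimate serves twice: pointwise it bounds \<open>1 / \<lambda>\<close>, and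
  uniformly it gives normality. Normality is an issue because \<open>D\<close> is unbounded, while
  the square root trick starts from a subset of the disc. The truncations of \<open>D\<close> may be
  disconnected, hence are not covered by the disc; this is why inverse branches, not coverings, are
  carried to the limit.\<close>

lemma norm_deriv_le_of_bounded:
  assumes hol: "h holomorphic_on ball z R" and "R > 0" and bd: "\<And>x. x \<in> ball z R \<Longrightarrow> norm (h x) \<le> B"
  shows "norm (deriv h z) * R \<le> B"
proof -
  have *: "norm (deriv h z) * s \<le> B" if s: "0 < s" "s < R" for s
  proof -
    have "norm ((deriv ^^ 1) h z) \<le> fact 1 * B / s ^ 1"
    proof (rule Cauchy_inequality)
      show "h holomorphic_on ball z s"
        by (rule holomorphic_on_subset[OF hol]) (use s in auto)
      show "continuous_on (cball z s) h"
        by (rule continuous_on_subset[OF holomorphic_on_imp_continuous_on[OF hol]]) (use s in auto)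
      show "norm (h x) \<le> B" if "norm (z - x) = s" for x
        by (rule bd) (use that s in \<open>simp add: dist_norm\<close>)
    qed (rule s(1))
    then show ?thesis using s by (simp add: field_simps)
  qed
  show ?thesis
  proof (cases "deriv h z = 0")
    case True
    have "z \<in> ball z R" using \<open>R > 0\<close> by simp
    from order_trans[OF norm_ge_zero bd[OF this]] True show ?thesis by simp
  next
    case False
    have "R \<le> B / norm (deriv h z)"
      by (rule dense_le_bounded[OF \<open>R > 0\<close>]) (use * False in \<open>simp add: field_simps\<close>)
    then show ?thesis using False by (simp add: field_simps)
  qed
qed

section \<open>Moebius maps, inverse branches and the square root trick\<close>

lemma Moebius_function_has_derivative:
  assumes "norm w < 1" "norm z < 1"
  shows "(Moebius_function 0 w has_field_derivative (1 - (norm w)\<^sup>2) / (1 - cnj w * z)\<^sup>2) (at z)"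
proof -
  have "norm (cnj w * z) < 1"
    using assms mult_strict_mono'[of "norm w" 1 "norm z" 1] by (simp add: norm_mult)
  then have nz: "1 - cnj w * z \<noteq> 0" by auto
  have "((\<lambda>z. (z - w) / (1 - cnj w * z)) has_field_derivative
      ((1 - cnj w * z) - (z - w) * (- cnj w)) / (1 - cnj w * z)\<^sup>2) (at z)"
    using nz by (auto intro!: derivative_eq_intros simp: power2_eq_square)
  moreover have "(1 - cnj w * z) - (z - w) * (- cnj w) = of_real (1 - (norm w)\<^sup>2)"
    using complex_norm_square[of w] by (simp add: algebra_simps)
  ultimately show ?thesis
    by (simp only: Moebius_function_simple[abs_def])
qed

text \<open>
  Inverse branches of \<open>F\<close> through prescribed points over every disc in \<open>D\<close>: this is what is needed of
  a covering map, but it makes sense for disconnected \<open>U\<close> and \<open>D\<close> and passes to normal limits.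
\<close>

definition branch_map :: "(complex \<Rightarrow> complex) \<Rightarrow> complex set \<Rightarrow> complex set \<Rightarrow> bool" where
  "branch_map F U D \<longleftrightarrow> open U \<and> U \<subseteq> ball 0 1 \<and> F holomorphic_on U \<and> F ` U \<subseteq> D \<and>
     (\<forall>w r z. ball w r \<subseteq> D \<longrightarrow> z \<in> U \<longrightarrow> F z \<in> ball w r \<longrightarrow>
        (\<exists>g. g holomorphic_on ball w r \<and> g ` ball w r \<subseteq> U \<and> g (F z) = z \<and>
             (\<forall>x\<in>ball w r. F (g x) = x)))"

lemma branch_mapD:
  assumes "branch_map F U D"
  shows "open U" "U \<subseteq> ball 0 1" "F holomorphic_on U" "F ` U \<subseteq> D"
  using assms unfolding branch_map_def by auto

lemma branch_mapE:
  assumes "branch_map F U D" "ball w r \<subseteq> D" "z \<in> U" "F z \<in> ball w r"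
  obtains g where "g holomorphic_on ball w r" "g ` ball w r \<subseteq> U" "g (F z) = z"
     "\<And>x. x \<in> ball w r \<Longrightarrow> F (g x) = x"
  using assms unfolding branch_map_def by metis

text \<open>
  Koebe's square root trick: \<open>F\<close> is composed with a two-sheeted self-map \<open>q\<close> of the disc that fixes \<open>0\<close>
  and is branched only over the omitted point \<open>a\<close>.
\<close>

lemma branch_map_sqrt_step:
  assumes F: "branch_map F U D" and "0 \<in> U" and a: "norm a < 1" "a \<notin> U"
  obtains F' U' where "branch_map F' U' D" "0 \<in> U'" "F' 0 = F 0"
    "norm (deriv F' 0) = norm (deriv F 0) * (2 * sqrt (norm a) / (1 + norm a))"
proof -
  note F' = branch_mapD[OF F]
  \<comment> \<open>This choice makes \<open>q\<close> fix 0: \<open>Tc\<close> sends 0 to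
    \<open>c\<close>, squaring gives \<open>- a\<close>, and \<open>Ta\<close> sends
    \<open>- a\<close> to 0. The squaring is branched over 0, which \<open>Ta\<close> sends to the
    omitted point \<open>a\<close>.\<close>
  define c where "c = csqrt (- a)"
  have c2: "c\<^sup>2 = - a" by (simp add: c_def)
  have nc: "(norm c)\<^sup>2 = norm a" by (metis c2 norm_minus_cancel norm_power)
  have c1: "norm c < 1" using nc a(1) by (metis norm_ge_zero power2_less_imp_less power_one zero_le_one)
  define Ta Tc where "Ta = Moebius_function 0 (- a)" and "Tc = Moebius_function 0 (- c)"
  define q where "q = (\<lambda>z. Ta ((Tc z)\<^sup>2))"
  have Tc_lt: "norm (Tc z) < 1" if "norm z < 1" for z
    unfolding Tc_def using that c1 by (intro Moebius_function_norm_lt_1) auto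
  have Ta_lt: "norm (Ta z) < 1" if "norm z < 1" for z
    unfolding Ta_def using that a by (intro Moebius_function_norm_lt_1) auto
  have sq_lt: "norm (z\<^sup>2) < 1" if "norm z < 1" for z :: complex
    using that by (simp add: norm_power abs_square_less_1)
  have q_lt: "norm (q z) < 1" if "norm z < 1" for z
    unfolding q_def using that by (intro Ta_lt sq_lt Tc_lt)
  have holTc: "Tc holomorphic_on ball 0 1" and holTa: "Ta holomorphic_on ball 0 1"
    unfolding Tc_def Ta_def using c1 a by (auto intro!: Moebius_function_holomorphic)
  have holq: "q holomorphic_on ball 0 1"
  proof -
    have "(Ta \<circ> (\<lambda>z. (Tc z)\<^sup>2)) holomorphic_on ball 0 1"
      by (rule holomorphic_on_compose_gen[OF _ holTa])
         (use holTc in \<open>auto intro!: holomorphic_intros simp: sq_lt Tc_lt simp del: norm_power\<close>)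
    then show ?thesis by (simp add: q_def o_def)
  qed
  have Tc0: "Tc 0 = c" by (simp add: Tc_def Moebius_function_of_zero)
  have q0: "q 0 = 0"
    by (simp add: q_def Tc0 c2 Ta_def Moebius_function_eq_zero)
  define U' where "U' = ball 0 1 \<inter> q -` U"
  have openU': "open U'"
    unfolding U'_def
    by (intro continuous_open_preimage holomorphic_on_imp_continuous_on holq) (auto simp: F')
  have bm: "branch_map (F \<circ> q) U' D"
    unfolding branch_map_def
  proof (intro conjI allI impI)
    show "open U'" by (rule openU')
    show "U' \<subseteq> ball 0 1" by (auto simp: U'_def)
    show "F \<circ> q holomorphic_on U'"
      by (rule holomorphic_on_compose_gen[OF _ F'(3)])
         (use holq in \<open>auto simp: U'_def intro: holomorphic_on_subset\<close>)
    show "(F \<circ> q) ` U' \<subseteq> D" using F'(4) by (auto simp: U'_def)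
    fix w r z assume wr: "ball w r \<subseteq> D" and z: "z \<in> U'" and "(F \<circ> q) z \<in> ball w r"
    then have z1: "norm z < 1" and qz: "q z \<in> U" and Fqz: "F (q z) \<in> ball w r"
      by (auto simp: U'_def)
    obtain g where g: "g holomorphic_on ball w r" "g ` ball w r \<subseteq> U" "g (F (q z)) = q z"
       "\<And>x. x \<in> ball w r \<Longrightarrow> F (g x) = x"
      using branch_mapE[OF F wr qz Fqz] by blast
    define p where "p = (\<lambda>x. Moebius_function 0 a (g x))"
    have g1: "norm (g x) < 1" if "x \<in> ball w r" for x
      using g(2) F'(2) that by (metis image_subset_iff mem_ball_0 subsetD)
    have Tap: "Ta (p x) = g x" if "x \<in> ball w r" for x
      unfolding Ta_def p_def
      by (rule Moebius_function_compose) (use a g1[OF that] in auto)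
    have p1: "norm (p x) < 1" if "x \<in> ball w r" for x
      unfolding p_def using a g1[OF that] by (intro Moebius_function_norm_lt_1)
    have p0: "p x \<noteq> 0" if "x \<in> ball w r" for x
    proof
      assume "p x = 0"
      then have "g x = Ta 0" using Tap[OF that] by simp
      also have "\<dots> = a" by (simp add: Ta_def Moebius_function_of_zero)
      finally have "g x = a" .
      moreover have "g x \<in> U" using g(2) that by blast
      ultimately show False using a(2) by simp
    qed
    have holp: "p holomorphic_on ball w r"
    proof -
      have "(Moebius_function 0 a \<circ> g) holomorphic_on ball w r"
        by (rule holomorphic_on_compose_gen[OF g(1) Moebius_function_holomorphic])
           (use a g1 in auto)
      then show ?thesis by (simp add: p_def o_def)
    qed
    obtain h where h: "h holomorphic_on ball w r" "\<And>x. x \<in> ball w r \<Longrightarrow> exp (h x) = p x"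
    proof -
      obtain h where "h holomorphic_on ball w r" "\<And>x. x \<in> ball w r \<Longrightarrow> exp (h x) = p x"
        using holomorphic_logarithm_exists[of "ball w r" p "F (q z)"] holp p0 Fqz by auto
      then show ?thesis using that by blast
    qed
    define s where "s = (\<lambda>x. exp (h x / 2))"
    have s2: "(s x)\<^sup>2 = p x" if "x \<in> ball w r" for x
      using h(2)[OF that] by (simp add: s_def flip: exp_double)
    have "p (F (q z)) = (Tc z)\<^sup>2"
    proof -
      have "p (F (q z)) = Moebius_function 0 a (Moebius_function 0 (-a) ((Tc z)\<^sup>2))"
        by (simp add: p_def g(3)) (simp add: q_def Ta_def)
      also have "\<dots> = (Tc z)\<^sup>2"
        by (rule Moebius_function_compose) (use a sq_lt Tc_lt z1 in auto)
      finally show ?thesis .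
    qed
    then have "(s (F (q z)))\<^sup>2 = (Tc z)\<^sup>2" using s2 Fqz by simp
    \<comment> \<open>The logarithm yields one of the two square roots of \<open>p\<close>; the sign
      \<open>e\<close> selects the root whose branch passes through the prescribed point
      \<open>z\<close>.\<close>
    then obtain e :: complex where e: "e\<^sup>2 = 1" "e * s (F (q z)) = Tc z"
      by (metis mult_1 mult_minus1 one_power2 power2_eq_iff power2_minus minus_minus)
    have e1: "norm e = 1" using e(1) by (metis norm_one norm_power power2_eq_1_iff norm_minus_cancel power2_eq_1_iff)
    define k where "k = (\<lambda>x. Moebius_function 0 c (e * s x))"
    have ns: "norm (e * s x) < 1" if "x \<in> ball w r" for x
    proof -
      have "(norm (s x))\<^sup>2 < 1" using s2[OF that] p1[OF that] by (metis norm_power)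
      then show ?thesis by (simp add: norm_mult e1 abs_square_less_1)
    qed
    have k1: "norm (k x) < 1" if "x \<in> ball w r" for x
      unfolding k_def using c1 ns[OF that] by (intro Moebius_function_norm_lt_1)
    have qk: "q (k x) = g x" if "x \<in> ball w r" for x
    proof -
      have "Tc (k x) = e * s x" unfolding Tc_def k_def
        by (rule Moebius_function_compose) (use c1 ns[OF that] in auto)
      then show ?thesis using e(1) s2[OF that] Tap[OF that] by (simp add: q_def power_mult_distrib)
    qed
    show "\<exists>g. g holomorphic_on ball w r \<and> g ` ball w r \<subseteq> U' \<and> g ((F \<circ> q) z) = z \<and>
        (\<forall>x\<in>ball w r. (F \<circ> q) (g x) = x)"
    proof (intro exI[of _ k] conjI)
      have "(Moebius_function 0 c \<circ> (\<lambda>x. e * s x)) holomorphic_on ball w r"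
        by (rule holomorphic_on_compose_gen[OF _ Moebius_function_holomorphic[OF c1]])
           (use ns h(1) in \<open>auto simp: s_def intro!: holomorphic_intros\<close>)
      then show "k holomorphic_on ball w r" by (simp add: k_def o_def)
      show "k ` ball w r \<subseteq> U'"
        using k1 qk g(2) by (auto simp: U'_def image_subset_iff)
      have "k (F (q z)) = z" unfolding k_def e(2) Tc_def
        by (rule Moebius_function_compose) (use c1 z1 in auto)
      then show "k ((F \<circ> q) z) = z" by simp
      show "\<forall>x\<in>ball w r. (F \<circ> q) (k x) = x" using qk g(4) by simp
    qed
  qed
  have dq: "(q has_field_derivative (1 / (1 - norm a ^ 2)) * (2 * c * (1 - norm a))) (at 0)"
  proof -
    have d1: "(Tc has_field_derivative of_real (1 - norm a)) (at 0)"
      using Moebius_function_has_derivative[of "-c" 0] c1 nc by (simp add: Tc_def flip: of_real_power)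
    have "1 - norm a ^ 2 \<noteq> 0" using a(1) abs_square_less_1[of "norm a"] by simp
    moreover have "1 - cnj (- a) * (- a) = of_real (1 - norm a ^ 2)"
      using complex_norm_square[of a] by (simp add: mult.commute)
    moreover have "complex_of_real N / (complex_of_real N)\<^sup>2 = of_real (1 / N)" if "N \<noteq> 0" for N
      using that by (simp add: power2_eq_square)
    ultimately have d2: "(Ta has_field_derivative of_real (1 / (1 - norm a ^ 2))) (at ((Tc 0)\<^sup>2))"
      using Moebius_function_has_derivative[of "-a" "-a"] a unfolding Ta_def Tc0 c2 norm_minus_cancel
      by metis
    have "((\<lambda>z. (Tc z)\<^sup>2) has_field_derivative (2 * c * (1 - norm a))) (at 0)"
      using d1 by (auto intro!: derivative_eq_intros simp: Tc0)
    from DERIV_chain2[OF d2 this] show ?thesis by (simp add: q_def)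
  qed
  have dF: "(F has_field_derivative deriv F 0) (at (q 0))"
    using F' \<open>0 \<in> U\<close> by (simp add: q0 holomorphic_derivI)
  have "deriv (F \<circ> q) 0 = deriv F 0 * ((1 / (1 - norm a ^ 2)) * (2 * c * (1 - norm a)))"
    using DERIV_chain[OF dF dq] by (intro DERIV_imp_deriv) auto
  \<comment> \<open>This factor is less than 1, since \<open>(1 - sqrt (norm a)) ^ 2\<close> is
    positive. The strict decrease of the derivative at 0 is the whole gain of the trick.\<close>
  moreover have "norm ((1 / (1 - norm a ^ 2)) * (2 * c * (1 - norm a))) = 2 * sqrt (norm a) / (1 + norm a)"
  proof -
    have "norm c = sqrt (norm a)" using nc by (metis norm_ge_zero real_sqrt_unique)
    have "(1 / (1 - norm a ^ 2)) * (2 * norm c * (1 - norm a)) = 2 * norm c / (1 + norm a)"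
    proof -
      have "1 - norm a ^ 2 = (1 - norm a) * (1 + norm a)" by (simp add: algebra_simps power2_eq_square)
      then show ?thesis using a(1) by simp
    qed
    moreover have "norm ((1 / (1 - complex_of_real (norm a ^ 2))) * (2 * c * (1 - complex_of_real (norm a))))
       = (1 / (1 - norm a ^ 2)) * (2 * norm c * (1 - norm a))"
    proof -
      have "norm (1 - complex_of_real (norm a ^ 2)) = 1 - norm a ^ 2"
        using a(1) abs_square_le_1[of "norm a"] by (metis abs_norm_cancel abs_of_nonneg diff_ge_0_iff_ge less_imp_le norm_of_real of_real_1 of_real_diff)
      moreover have "norm (1 - complex_of_real (norm a)) = 1 - norm a"
        using a(1) by (metis abs_of_nonneg diff_ge_0_iff_ge less_imp_le norm_of_real of_real_1 of_real_diff)
      ultimately show ?thesis by (simp only: norm_mult norm_divide norm_one) simp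
    qed
    ultimately show ?thesis by (simp add: \<open>norm c = _\<close>)
  qed
  ultimately have "norm (deriv (F \<circ> q) 0) = norm (deriv F 0) * (2 * sqrt (norm a) / (1 + norm a))"
    by (simp only: norm_mult)
  moreover have "0 \<in> U'" using \<open>0 \<in> U\<close> by (simp add: U'_def q0)
  ultimately show ?thesis using that[OF bm] q0 by simp
qed

section \<open>From inverse branches to covering maps\<close>

lemma holomorphic_sections_agree:
  assumes "connected T" "open T" "g1 holomorphic_on T" "g2 holomorphic_on T"
    and "\<And>x. x \<in> T \<Longrightarrow> p (g1 x) = x" "\<And>x. x \<in> T \<Longrightarrow> p (g2 x) = x"
    and "x1 \<in> T" "x2 \<in> T" "g1 x1 = g2 x2" "y \<in> T"
  shows "g1 y = g2 y"
proof -
  have x12: "x1 = x2" using assms by metis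
  have inj: "inj_on g1 T" by (rule inj_on_inverseI) (rule assms(5))
  have op: "open (g1 ` T)" by (rule open_mapping_thm3[OF assms(3,2) inj])
  define S where "S = T \<inter> g2 -` (g1 ` T)"
  have "open S" unfolding S_def
    by (intro continuous_open_preimage holomorphic_on_imp_continuous_on assms op)
  have eq: "g1 x = g2 x" if x: "x \<in> S" for x
  proof -
    obtain x' where "x' \<in> T" "g2 x = g1 x'" "x \<in> T" using x unfolding S_def by blast
    then show ?thesis using assms(5)[of x'] assms(6)[of x] by simp
  qed
  have "x1 \<in> S" using assms(7,9) x12 unfolding S_def by (metis IntI image_eqI vimageI)
  then have "S \<noteq> {}" "S \<subseteq> T" by (auto simp: S_def)
  then show ?thesis
    using analytic_continuation_open[OF \<open>open S\<close> assms(2) _ assms(1) _ assms(3,4) eq assms(10)]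
    by blast
qed

text \<open>A disc in \<open>D\<close> that meets the image lies in the image, because a branch
  through one point is a section over the whole disc. So the image and its complement in
  \<open>D\<close> are both open.\<close>

lemma branch_map_disc_surj:
  assumes p: "branch_map p (ball 0 1) D" and D: "open D" "connected D"
  shows "p ` ball 0 1 = D"
proof
  show "p ` ball 0 1 \<subseteq> D" by (rule branch_mapD(4)[OF p])
  let ?X = "p ` ball 0 1"
  have alt: "ball w r \<subseteq> ?X \<or> ball w r \<inter> ?X = {}" if "ball w r \<subseteq> D" for w r
  proof -
    { fix z assume "z \<in> ball (0::complex) 1" "p z \<in> ball w r"
      from branch_mapE[OF p that this]
      have "ball w r \<subseteq> ?X" by (metis image_eqI image_subset_iff subsetI) }
    then show ?thesis by blast
  qed
  have "open ?X"
  proof (rule openI)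
    fix x assume x: "x \<in> ?X"
    then have "x \<in> D" using branch_mapD(4)[OF p] by blast
    then obtain e where e: "e > 0" "ball x e \<subseteq> D" using D(1) open_contains_ball by blast
    then have "x \<in> ball x e" by simp
    then have "ball x e \<subseteq> ?X" using alt[OF e(2)] x by blast
    then show "\<exists>e>0. ball x e \<subseteq> ?X" using e(1) by blast
  qed
  moreover have "open (D - ?X)"
  proof (rule openI)
    fix x assume "x \<in> D - ?X"
    then obtain e where e: "e > 0" "ball x e \<subseteq> D" using D(1) open_contains_ball by blast
    then have "x \<in> ball x e" by simp
    then have "ball x e \<inter> ?X = {}" using alt[OF e(2)] \<open>x \<in> D - ?X\<close> by blast
    then show "\<exists>e>0. ball x e \<subseteq> D - ?X" using e by blast
  qed
  moreover have "p 0 \<in> ?X \<inter> D" using branch_mapD(4)[OF p] by auto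
  ultimately show "D \<subseteq> ?X"
    using connectedD[OF D(2), of ?X "D - ?X"] by blast
qed

text \<open>Every disc in \<open>D\<close> is evenly covered: its sheets are the images of all its
  holomorphic sections into the unit disc. The branches exhaust the preimage, and two sections whose
  images meet are equal.\<close>

lemma branch_map_disc_covering:
  assumes p: "branch_map p (ball 0 1) D" and D: "open D" "connected D"
  shows "holomorphic_universal_covering p D"
  unfolding holomorphic_universal_covering_def
proof
  show hol: "p holomorphic_on ball 0 1" by (rule branch_mapD(3)[OF p])
  show "covering_space (ball 0 1) p D"
  proof
    show "continuous_on (ball 0 1) p" by (rule holomorphic_on_imp_continuous_on[OF hol])
    show "p ` ball 0 1 = D" by (rule branch_map_disc_surj[OF assms])
    fix w assume "w \<in> D"
    then obtain r where r: "r > 0" "ball w r \<subseteq> D" using D(1) open_contains_ball by metis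
    define T where "T = ball w r"
    define V where "V = {g ` T | g. g holomorphic_on T \<and> g ` T \<subseteq> ball 0 1 \<and> (\<forall>x\<in>T. p (g x) = x)}"
    show "\<exists>T. w \<in> T \<and> openin (top_of_set D) T \<and>
           (\<exists>v. \<Union> v = ball 0 1 \<inter> p -` T \<and> (\<forall>u\<in>v. openin (top_of_set (ball 0 1)) u) \<and>
             pairwise disjnt v \<and> (\<forall>u\<in>v. \<exists>q. homeomorphism u T p q))"
    proof (intro exI[of _ T] conjI exI[of _ V] ballI)
      show "w \<in> T" using r by (simp add: T_def)
      show "openin (top_of_set D) T" using r D by (simp add: T_def openin_open_eq)
      show "\<Union> V = ball 0 1 \<inter> p -` T"
      proof
        show "\<Union> V \<subseteq> ball 0 1 \<inter> p -` T"
        proof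
          fix y assume "y \<in> \<Union> V"
          then obtain g x where "x \<in> T" "y = g x" "g ` T \<subseteq> ball 0 1" "\<forall>x\<in>T. p (g x) = x"
            unfolding V_def by blast
          then show "y \<in> ball 0 1 \<inter> p -` T" by (metis IntI imageI subsetD vimageI)
        qed
        show "ball 0 1 \<inter> p -` T \<subseteq> \<Union> V"
        proof
          fix z assume z: "z \<in> ball 0 1 \<inter> p -` T"
          then obtain g where "g holomorphic_on T" "g ` T \<subseteq> ball 0 1" "g (p z) = z"
            "\<And>x. x \<in> T \<Longrightarrow> p (g x) = x"
            using branch_mapE[OF p r(2), of z] unfolding T_def by blast
          then have "g ` T \<in> V" unfolding V_def by blast
          moreover have "z \<in> g ` T" using z \<open>g (p z) = z\<close> by (metis IntD2 imageI vimageD)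
          ultimately show "z \<in> \<Union> V" by blast
        qed
      qed
      fix u assume "u \<in> V"
      then obtain g where g: "u = g ` T" "g holomorphic_on T" "g ` T \<subseteq> ball 0 1" "\<forall>x\<in>T. p (g x) = x"
        unfolding V_def by blast
      have "inj_on g T" using g(4) by (intro inj_on_inverseI[of _ p]) blast
      then have "open u" unfolding g(1)
        by (intro open_mapping_thm3[OF g(2)]) (simp_all add: T_def)
      then show "openin (top_of_set (ball 0 1)) u" using g(1,3) by (simp add: openin_open_eq)
      show "\<exists>q. homeomorphism u T p q"
      proof
        show "homeomorphism u T p g"
          unfolding homeomorphism_def
        proof (intro conjI)
          show "continuous_on u p" using hol g(1,3)
            by (metis continuous_on_subset holomorphic_on_imp_continuous_on)
          show "continuous_on T g" using g(2) by (rule holomorphic_on_imp_continuous_on)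
          show "p ` u = T" unfolding g(1) image_image using g(4) by simp
          show "\<forall>x\<in>u. g (p x) = x" "\<forall>y\<in>T. p (g y) = y" using g(1,4) by auto
        qed (simp add: g(1))
      qed
    next
      show "pairwise disjnt V"
        unfolding pairwise_def
      proof (intro ballI impI)
        fix u1 u2 assume "u1 \<in> V" "u2 \<in> V" and ne: "u1 \<noteq> u2"
        then obtain g1 g2 where g1: "u1 = g1 ` T" "g1 holomorphic_on T" "\<And>x. x\<in>T \<Longrightarrow> p (g1 x) = x"
          and g2: "u2 = g2 ` T" "g2 holomorphic_on T" "\<And>x. x\<in>T \<Longrightarrow> p (g2 x) = x"
          unfolding V_def by blast
        have "connected T" "open T" by (auto simp: T_def)
        show "disjnt u1 u2"
        proof (rule ccontr)
          assume "\<not> disjnt u1 u2"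
          then obtain y where y: "y \<in> g1 ` T" "y \<in> g2 ` T"
            unfolding disjnt_def g1(1) g2(1) by blast
          obtain x1 where x1: "x1 \<in> T" "y = g1 x1" using y(1) by (rule imageE)
          obtain x2 where x2: "x2 \<in> T" "y = g2 x2" using y(2) by (rule imageE)
          have "g1 x1 = g2 x2" using x1(2) x2(2) by simp
          then have "g1 y = g2 y" if "y \<in> T" for y
            using holomorphic_sections_agree[of T g1 g2 p x1 x2 y] \<open>connected T\<close> \<open>open T\<close> g1(2,3) g2(2,3)
              x1(1) x2(1) that by blast
          then have "g1 ` T = g2 ` T" by (rule image_cong[OF refl])
          then show False using ne g1(1) g2(1) by simp
        qed
      qed
    qed
  qed
qed

section \<open>The extremal problem for bounded pieces\<close>

text \<open>The branch at \<open>F 0\<close> maps a disc of radius \<open>r\<close> into the unit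
  disc, so its derivative is at most \<open>1 / r\<close>, and that derivative is the reciprocal of
  \<open>deriv F 0\<close>. Hence the infimum in the extremal problem is positive.\<close>

lemma branch_map_deriv_ge:
  assumes F: "branch_map F U D" and "0 \<in> U" "r > 0" "ball (F 0) r \<subseteq> D"
  shows "r \<le> norm (deriv F 0)"
proof -
  obtain g where g: "g holomorphic_on ball (F 0) r" "g ` ball (F 0) r \<subseteq> U" "g (F 0) = 0"
     "\<And>x. x \<in> ball (F 0) r \<Longrightarrow> F (g x) = x"
    using branch_mapE[OF F assms(4,2) centre_in_ball[THEN iffD2, OF \<open>r > 0\<close>]] by blast
  define w where "w = F 0"
  have g1: "norm (g x) < 1" if "x \<in> ball w r" for x
  proof -
    have "g x \<in> U" using g(2) that unfolding w_def by blast
    then show ?thesis using branch_mapD(2)[OF F] by auto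
  qed
  have dg: "(g has_field_derivative deriv g w) (at w)"
    using g(1) \<open>r > 0\<close> by (intro holomorphic_derivI[of _ "ball w r"]) (auto simp: w_def)
  have dF: "(F has_field_derivative deriv F 0) (at (g w))"
    using branch_mapD(1,3)[OF F] \<open>0 \<in> U\<close> g(3) by (auto simp: w_def intro: holomorphic_derivI)
  have "((F \<circ> g) has_field_derivative (deriv F 0 * deriv g w)) (at w)"
    by (rule DERIV_chain[OF dF dg])
  moreover have "((F \<circ> g) has_field_derivative 1) (at w)"
    by (rule has_field_derivative_transform_within_open[of "\<lambda>x. x" _ _ "ball w r"])
       (use g(4) \<open>r > 0\<close> in \<open>auto simp: w_def\<close>)
  ultimately have eq: "deriv F 0 * deriv g w = 1" by (rule DERIV_unique)
  have "norm (deriv g w) * r \<le> 1"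
    by (rule norm_deriv_le_of_bounded[OF g(1)[folded w_def] \<open>r > 0\<close>]) (use g1 less_imp_le in blast)
  then have "norm (deriv F 0) * (norm (deriv g w) * r) \<le> norm (deriv F 0) * 1"
    by (rule mult_left_mono) simp
  moreover have "norm (deriv F 0) * norm (deriv g w) = 1" using eq by (metis norm_mult norm_one)
  ultimately show ?thesis by (simp add: mult.assoc[symmetric])
qed

text \<open>
  If \<open>\<bar>F' 0\<bar>\<close> is nearly minimal, the square root trick cannot decrease it much, so every point of the disc
  omitted by \<open>U\<close> lies close to the unit circle.
\<close>

lemma branch_map_bounded_exists:
  assumes "open D" "w \<in> D" "bounded D" "e > 0"
  obtains F U where "branch_map F U D" "0 \<in> U" "F 0 = w" "ball 0 (1 - e) \<subseteq> U"
proof -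
  obtain r where r: "r > 0" "ball w r \<subseteq> D" using assms open_contains_ball by metis
  obtain R where R: "R > 0" "D \<subseteq> ball w R"
    using bounded_subset_ballD[OF \<open>bounded D\<close>, of w] by blast
  define S where "S = {norm (deriv F 0) | F U. branch_map F U D \<and> 0 \<in> U \<and> F 0 = w}"
  \<comment> \<open>The starting competitor: a bounded \<open>D\<close> fits into
    \<open>ball w R\<close>, so its rescaled copy lies in the unit disc and the affine map has
    trivial inverse branches.\<close>
  define U0 where "U0 = {z. w + of_real R * z \<in> D}"
  have "branch_map (\<lambda>z. w + of_real R * z) U0 D"
    unfolding branch_map_def
  proof (intro conjI allI impI)
    have "U0 = (\<lambda>z. w + of_real R * z) -` D" by (auto simp: U0_def)
    then show "open U0" using \<open>open D\<close> by (auto intro!: open_vimage continuous_intros)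
    show "U0 \<subseteq> ball 0 1" 
    proof
      fix z assume "z \<in> U0"
      then have "w + of_real R * z \<in> ball w R" using R(2) by (auto simp: U0_def)
      then show "z \<in> ball 0 1" using R(1) by (simp add: dist_norm norm_mult)
    qed
    show "(\<lambda>z. w + of_real R * z) ` U0 \<subseteq> D" by (auto simp: U0_def)
    show "(\<lambda>z. w + of_real R * z) holomorphic_on U0" by (intro holomorphic_intros)
    fix w' r' z assume *: "ball w' r' \<subseteq> D" 
    show "\<exists>g. g holomorphic_on ball w' r' \<and> g ` ball w' r' \<subseteq> U0 \<and> g (w + of_real R * z) = z \<and>
             (\<forall>x\<in>ball w' r'. w + of_real R * g x = x)"
      by (rule exI[of _ "\<lambda>x. (x - w) / of_real R"])
         (use R(1) * in \<open>auto simp: U0_def intro!: holomorphic_intros\<close>)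
  qed
  moreover have "0 \<in> U0" using assms by (simp add: U0_def)
  ultimately have "norm (deriv (\<lambda>z. w + of_real R * z) 0) \<in> S"
    unfolding S_def by (intro CollectI exI[of _ "\<lambda>z. w + of_real R * z"] exI[of _ U0]) simp
  then have "S \<noteq> {}" by blast
  have S: "r \<le> x" if "x \<in> S" for x
  proof -
    obtain F U where "branch_map F U D" "0 \<in> U" "F 0 = w" "x = norm (deriv F 0)"
      using \<open>x \<in> S\<close> unfolding S_def by blast
    then show ?thesis using branch_map_deriv_ge[of F U D r] r by simp
  qed
  then have bdd: "bdd_below S" by (rule bdd_belowI)
  define m where "m = Inf S"
  have m: "m \<ge> r" unfolding m_def using \<open>S \<noteq> {}\<close> S by (rule cInf_greatest)
  \<comment> \<open>An almost minimal map suffices. The tolerance is calibrated for an omitted point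
    \<open>a\<close> with \<open>s = sqrt (norm a)\<close>: from
    \<open>1 + s ^ 2 < (1 + e ^ 2 / 8) * (2 * s)\<close> follows
    \<open>(1 - s) ^ 2 < (e / 2) ^ 2\<close>, and then
    \<open>norm a \<ge> 2 * s - 1 > 1 - e\<close>.\<close>
  have "m < m * (1 + e\<^sup>2 / 8)" using m r assms by simp
  then obtain x where "x \<in> S" "x < m * (1 + e\<^sup>2 / 8)"
    unfolding m_def using cInf_lessD[OF \<open>S \<noteq> {}\<close>] by blast
  then obtain F U where F: "branch_map F U D" "0 \<in> U" "F 0 = w"
    and less: "norm (deriv F 0) < m * (1 + e\<^sup>2 / 8)" unfolding S_def by blast
  have "a \<in> U" if "a \<in> ball 0 (1 - e)" for a
  proof (rule ccontr)
    assume "a \<notin> U"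
    have a1: "norm a < 1 - e" "norm a < 1" using that assms(4) by auto
    obtain F' U' where F': "branch_map F' U' D" "0 \<in> U'" "F' 0 = F 0"
      "norm (deriv F' 0) = norm (deriv F 0) * (2 * sqrt (norm a) / (1 + norm a))"
      using branch_map_sqrt_step[OF F(1,2) a1(2) \<open>a \<notin> U\<close>] .
    have "norm (deriv F' 0) \<in> S" unfolding S_def using F'(1-3) F(3) by blast
    then have "m \<le> norm (deriv F' 0)" unfolding m_def using bdd by (rule cInf_lower)
    also note F'(4)
    finally have *: "m \<le> norm (deriv F 0) * (2 * sqrt (norm a) / (1 + norm a))" .
    define s where "s = sqrt (norm a)"
    have s: "s \<ge> 0" "s\<^sup>2 = norm a" "s < 1" using a1 by (auto simp: s_def)
    have "a \<noteq> 0" using \<open>a \<notin> U\<close> F by metis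
    then have "s > 0" by (simp add: s_def)
    have "1 + s\<^sup>2 > 0" by (simp add: add_pos_nonneg)
    have "m * (1 + s\<^sup>2) \<le> norm (deriv F 0) * (2 * s)"
      using * \<open>1 + s\<^sup>2 > 0\<close> by (simp add: s(2) s_def[symmetric] field_simps)
    also have "\<dots> < (m * (1 + e\<^sup>2 / 8)) * (2 * s)" using less \<open>s > 0\<close> by simp
    finally have "m * (1 + s\<^sup>2) < m * ((1 + e\<^sup>2 / 8) * (2 * s))" by (simp add: mult_ac)
    then have "1 + s\<^sup>2 < (1 + e\<^sup>2 / 8) * (2 * s)" using m r by simp
    then have "(1 - s)\<^sup>2 < e\<^sup>2 / 4 * s" by (simp add: power2_eq_square algebra_simps)
    also have "\<dots> \<le> (e / 2)\<^sup>2" using s by (simp add: power2_eq_square mult_left_le)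
    finally have "1 - s < e / 2" 
    using assms power2_less_imp_less[of "1 - s" "e / 2"] by simp
    moreover have "s\<^sup>2 \<ge> 1 - 2 * (1 - s)"
      using zero_le_power2[of "1 - s"] by (simp add: power2_eq_square algebra_simps)
    ultimately show False using a1(1) s(2) by argo
  qed
  then have "ball 0 (1 - e) \<subseteq> U" by blast
  then show ?thesis by (rule that[OF F])
qed

section \<open>Normal limits of approximate coverings\<close>

lemma tendsto_uniform_limit_compose:
  fixes f :: "'a::topological_space \<Rightarrow> 'b::real_normed_vector"
  assumes ul: "uniform_limit K F f sequentially" and "continuous_on K f"
    and x: "x \<longlonglongrightarrow> a" and "a \<in> K" and K: "\<forall>\<^sub>F n in sequentially. x n \<in> K"
  shows "(\<lambda>n. F n (x n)) \<longlonglongrightarrow> f a"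
proof -
  have "(\<lambda>n. f (x n)) \<longlonglongrightarrow> f a"
    using continuous_on_tendsto_compose[OF assms(2) x assms(4) K] .
  moreover have "(\<lambda>n. F n (x n) - f (x n)) \<longlonglongrightarrow> 0"
  proof (rule tendstoI)
    fix e :: real assume "e > 0"
    from uniform_limitD[OF ul this] K
    show "\<forall>\<^sub>F n in sequentially. dist (F n (x n) - f (x n)) 0 < e"
      by eventually_elim (simp add: dist_norm)
  qed
  ultimately have "(\<lambda>n. (F n (x n) - f (x n)) + f (x n)) \<longlonglongrightarrow> 0 + f a"
    by (intro tendsto_add)
  then show ?thesis by simp
qed

text \<open>The \<open>f n\<close> will be slightly rescaled maps from bounded pieces of
  \<open>D\<close>. Therefore their branches land in a disc that is a little too large, invert
  \<open>f n\<close> only where they land in the unit disc, and exist over a given disc only from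
  some index on. All three defects vanish in the limit: Montel's theorem is applied to the maps and
  then to their branches, and the maximum principle returns the limit branches to the open
  disc.\<close>

lemma covering_limit:
  fixes f :: "nat \<Rightarrow> complex \<Rightarrow> complex"
  assumes "open D" "w0 \<in> D"
    and hol: "\<And>n. f n holomorphic_on ball 0 1"
    and into: "\<And>n z. norm z < 1 \<Longrightarrow> f n z \<in> D"
    and zero: "\<And>n. f n 0 = w0"
    and bound: "\<And>n z. norm z < 1 \<Longrightarrow> norm (deriv (f n) z) * (1 - norm z) \<le> C"
    and branch: "\<And>w r. ball w r \<subseteq> D \<Longrightarrow> \<exists>N. \<forall>n\<ge>N. \<forall>z. norm z < 1 \<longrightarrow> f n z \<in> ball w r \<longrightarrow>
        (\<exists>g. g holomorphic_on ball w r \<and> (\<forall>x\<in>ball w r. norm (g x) < 1 + 1 / (real n + 1)) \<and>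
             g (f n z) = z \<and> (\<forall>x\<in>ball w r. norm (g x) < 1 \<longrightarrow> f n (g x) = x))"
  obtains p where "branch_map p (ball 0 1) D" "p 0 = w0"
proof -
  have locbd: "\<exists>B. \<forall>h\<in>range f. \<forall>z\<in>K. norm (h z) \<le> B" if K: "compact K" "K \<subseteq> ball 0 1" for K
  proof -
    obtain \<rho> where \<rho>: "\<rho> \<ge> 0" "\<rho> < 1" "K \<subseteq> cball 0 \<rho>"
    proof (cases "K = {}")
      case False
      then obtain k where k: "k \<in> K" "\<forall>x\<in>K. norm x \<le> norm k"
        using continuous_attains_sup[OF K(1), of norm] continuous_on_norm_id by blast
      show ?thesis by (rule that[of "norm k"]) (use k K in auto)
    qed (use that[of 0] in auto)
    have "norm (f n z) \<le> norm w0 + C / (1 - \<rho>) * \<rho>" if z: "z \<in> K" for n z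
    proof -
      have "norm (f n z - f n 0) \<le> C / (1 - \<rho>) * norm (z - 0)"
      proof (rule field_differentiable_bound[OF convex_cball[of 0 \<rho>]])
        fix x :: complex assume x: "x \<in> cball 0 \<rho>"
        then have x1: "norm x < 1" using \<rho> by auto
        then show "(f n has_field_derivative deriv (f n) x) (at x within cball 0 \<rho>)"
          by (intro holomorphic_derivI[OF hol open_ball]) simp
        have "norm (deriv (f n) x) * (1 - \<rho>) \<le> norm (deriv (f n) x) * (1 - norm x)"
          using x by (intro mult_left_mono) auto
        also have "\<dots> \<le> C" by (rule bound[OF x1])
        finally show "norm (deriv (f n) x) \<le> C / (1 - \<rho>)" using \<rho> by (simp add: field_simps)
      qed (use \<rho> z in auto)
      also have "\<dots> \<le> C / (1 - \<rho>) * \<rho>"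
      proof (rule mult_left_mono)
        have "0 \<le> C" by (rule order_trans[OF _ bound[of 0 0]]) simp_all
        then show "0 \<le> C / (1 - \<rho>)" using \<rho> by simp
      qed (use \<rho> z in auto)
      finally have "norm (f n z - w0) \<le> C / (1 - \<rho>) * \<rho>" by (simp add: zero)
      then show ?thesis using norm_triangle_sub[of "f n z" w0] by linarith
    qed
    then show ?thesis by blast
  qed
  have holr: "h holomorphic_on ball 0 1" if "h \<in> range f" for h using that hol by auto
  obtain p \<sigma> where holp: "p holomorphic_on ball 0 1" and \<sigma>: "strict_mono (\<sigma> :: nat \<Rightarrow> nat)"
    and lim_p: "\<And>x. x \<in> ball 0 1 \<Longrightarrow> (\<lambda>n. f (\<sigma> n) x) \<longlonglongrightarrow> p x"
    and ul_p: "\<And>K. compact K \<Longrightarrow> K \<subseteq> ball 0 1 \<Longrightarrow> uniform_limit K (f \<circ> \<sigma>) p sequentially"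
    by (rule Montel[OF open_ball holr locbd order_refl], assumption+) (rule that)
  have p0: "p 0 = w0"
    using lim_p[of 0] zero by (simp add: LIMSEQ_const_iff)
  have branches: "\<exists>g. g holomorphic_on ball w r \<and> g ` ball w r \<subseteq> ball 0 1 \<and> g (p z) = z \<and>
             (\<forall>x\<in>ball w r. p (g x) = x)"
    if wr: "ball w r \<subseteq> D" and z: "z \<in> ball 0 1" and pz: "p z \<in> ball w r" for w r z
  proof -
    obtain N where N: "\<And>n z. n \<ge> N \<Longrightarrow> norm z < 1 \<Longrightarrow> f n z \<in> ball w r \<Longrightarrow>
        (\<exists>g. g holomorphic_on ball w r \<and> (\<forall>x\<in>ball w r. norm (g x) < 1 + 1 / (real n + 1)) \<and>
             g (f n z) = z \<and> (\<forall>x\<in>ball w r. norm (g x) < 1 \<longrightarrow> f n (g x) = x))"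
      using branch[OF wr] by blast
    have "\<forall>\<^sub>F n in sequentially. f (\<sigma> n) z \<in> ball w r"
      by (rule topological_tendstoD[OF lim_p[OF z] open_ball pz])
    then obtain M0 where M0: "\<And>n. n \<ge> M0 \<Longrightarrow> f (\<sigma> n) z \<in> ball w r"
      unfolding eventually_sequentially by blast
    define M where "M = max M0 N"
    have \<sigma>ge: "n \<le> \<sigma> n" for n using \<sigma> by (rule seq_suble)
    have "\<exists>g. g holomorphic_on ball w r \<and> (\<forall>x\<in>ball w r. norm (g x) < 1 + 1 / (real (\<sigma> (n + M)) + 1)) \<and>
             g (f (\<sigma> (n + M)) z) = z \<and> (\<forall>x\<in>ball w r. norm (g x) < 1 \<longrightarrow> f (\<sigma> (n + M)) (g x) = x)" for n
    proof (rule N)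
      show "N \<le> \<sigma> (n + M)" using \<sigma>ge[of "n + M"] by (simp add: M_def)
      show "f (\<sigma> (n + M)) z \<in> ball w r" by (rule M0) (simp add: M_def)
    qed (use z in simp)
    then obtain G where G: "\<And>n. G n holomorphic_on ball w r"
      "\<And>n x. x \<in> ball w r \<Longrightarrow> norm (G n x) < 1 + 1 / (real (\<sigma> (n + M)) + 1)"
      "\<And>n. G n (f (\<sigma> (n + M)) z) = z"
      "\<And>n x. x \<in> ball w r \<Longrightarrow> norm (G n x) < 1 \<Longrightarrow> f (\<sigma> (n + M)) (G n x) = x"
      by metis
    have G2: "norm (G n x) \<le> 2" if "x \<in> ball w r" for n x
    proof -
      have "1 / (real (\<sigma> (n + M)) + 1) \<le> 1" by simp
      then show ?thesis using G(2)[OF that, of n] by linarith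
    qed
    \<comment> \<open>The radii \<open>1 + 1 / (n + 1)\<close> never exceed 2, so the branches form
      a normal family of their own.\<close>
    have bd: "\<exists>B. \<forall>h\<in>range G. \<forall>z\<in>K. norm (h z) \<le> B" if "K \<subseteq> ball w r" for K
      using G2 that by (intro exI[of _ 2]) auto
    have holr: "h holomorphic_on ball w r" if "h \<in> range G" for h using that G(1) by auto
    obtain g \<tau> where holg: "g holomorphic_on ball w r" and \<tau>: "strict_mono (\<tau> :: nat \<Rightarrow> nat)"
      and lim_g: "\<And>x. x \<in> ball w r \<Longrightarrow> (\<lambda>n. G (\<tau> n) x) \<longlonglongrightarrow> g x"
      and ul_g: "\<And>K. compact K \<Longrightarrow> K \<subseteq> ball w r \<Longrightarrow> uniform_limit K (G \<circ> \<tau>) g sequentially"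
      by (rule Montel[OF open_ball holr bd order_refl], assumption+) (rule that)
    define \<kappa> where "\<kappa> n = \<tau> n + M" for n
    have \<kappa>: "strict_mono \<kappa>" using \<tau> by (auto simp: \<kappa>_def strict_mono_def)
    have \<sigma>\<kappa>: "n \<le> \<sigma> (\<kappa> n)" for n using seq_suble[OF \<kappa>, of n] \<sigma>ge[of "\<kappa> n"] by linarith
    have lim_p': "(\<lambda>n. f (\<sigma> (\<kappa> n)) x) \<longlonglongrightarrow> p x" if "x \<in> ball 0 1" for x
      using LIMSEQ_subseq_LIMSEQ[OF lim_p[OF that] \<kappa>] by (simp add: o_def)
    have ul_p': "uniform_limit K (\<lambda>n. f (\<sigma> (\<kappa> n))) p sequentially"
      if "compact K" "K \<subseteq> ball 0 1" for K
      using filterlim_compose[OF ul_p[OF that] filterlim_subseq[OF \<kappa>]] by (simp add: o_def)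
    have g_le: "norm (g x) \<le> 1" if x: "x \<in> ball w r" for x
    proof (rule LIMSEQ_le)
      show "(\<lambda>n. norm (G (\<tau> n) x)) \<longlonglongrightarrow> norm (g x)" by (intro tendsto_norm lim_g x)
      show "(\<lambda>n. 1 + 1 / (real n + 1)) \<longlonglongrightarrow> 1"
        using tendsto_add[OF tendsto_const LIMSEQ_inverse_real_of_nat, of 1]
        by (simp add: inverse_eq_divide add.commute)
      have "norm (G (\<tau> n) x) \<le> 1 + 1 / (real n + 1)" for n
      proof -
        have "1 / (real (\<sigma> (\<kappa> n)) + 1) \<le> 1 / (real n + 1)"
          using \<sigma>\<kappa>[of n] by (intro divide_left_mono) auto
        then show ?thesis using G(2)[OF x, of "\<tau> n"] unfolding \<kappa>_def by linarith
      qed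
      then show "\<exists>N. \<forall>n\<ge>N. norm (G (\<tau> n) x) \<le> 1 + 1 / (real n + 1)" by blast
    qed
    have gpz: "g (p z) = z"
    proof -
      obtain d where d: "d > 0" "cball (p z) d \<subseteq> ball w r"
        using pz open_contains_cball open_ball by metis
      have "(\<lambda>n. (G \<circ> \<tau>) n (f (\<sigma> (\<kappa> n)) z)) \<longlonglongrightarrow> g (p z)"
      proof (rule tendsto_uniform_limit_compose[where F = "G \<circ> \<tau>" and K = "cball (p z) d"
            and x = "\<lambda>n. f (\<sigma> (\<kappa> n)) z" and f = g])
        show "uniform_limit (cball (p z) d) (G \<circ> \<tau>) g sequentially" using ul_g d by simp
        show "continuous_on (cball (p z) d) g"
          using holg d(2) by (meson continuous_on_subset holomorphic_on_imp_continuous_on)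
        show "(\<lambda>n. f (\<sigma> (\<kappa> n)) z) \<longlonglongrightarrow> p z" by (rule lim_p'[OF z])
        then have "\<forall>\<^sub>F n in sequentially. f (\<sigma> (\<kappa> n)) z \<in> ball (p z) d"
          using d by (intro topological_tendstoD) auto
        then show "\<forall>\<^sub>F n in sequentially. f (\<sigma> (\<kappa> n)) z \<in> cball (p z) d"
          by eventually_elim auto
      qed (use d in auto)
      then show ?thesis using G(3) by (simp add: \<kappa>_def LIMSEQ_const_iff)
    qed
    have g_lt: "norm (g x) < 1" if x: "x \<in> ball w r" for x
    proof (rule ccontr)
      assume "\<not> norm (g x) < 1"
      then have gx: "norm (g x) = 1" using g_le[OF x] by simp
      \<comment> \<open>The limit only inherits modulus at most 1. Attaining 1 would make
        \<open>g\<close> constant of modulus 1, against \<open>g (p z) = z\<close> with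
        \<open>z\<close> inside the disc.\<close>
      have "g constant_on ball w r"
        by (rule maximum_modulus_principle[OF holg, of "ball w r" x])
           (use x g_le gx in auto)
      then have "g (p z) = g x" using pz x unfolding constant_on_def by metis
      then show False using gpz gx z by simp
    qed
    \<comment> \<open>As \<open>g x\<close> is already known to be interior, the approximating
      branches at \<open>x\<close> are eventually interior too. Only then do they satisfy the
      inversion identity that is passed to the limit.\<close>
    have pg: "p (g x) = x" if x: "x \<in> ball w r" for x
    proof -
      have "g x \<in> ball 0 1" using g_lt[OF x] by simp
      then obtain d where d: "d > 0" "cball (g x) d \<subseteq> ball 0 1"
        using open_contains_cball open_ball by metis
      have lim: "(\<lambda>n. G (\<tau> n) x) \<longlonglongrightarrow> g x" by (rule lim_g[OF x])
      then have "\<forall>\<^sub>F n in sequentially. G (\<tau> n) x \<in> ball (g x) d"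
        using d by (intro topological_tendstoD) auto
      then have ev: "\<forall>\<^sub>F n in sequentially. G (\<tau> n) x \<in> cball (g x) d"
        by eventually_elim auto
      have "(\<lambda>n. f (\<sigma> (\<kappa> n)) (G (\<tau> n) x)) \<longlonglongrightarrow> p (g x)"
      proof (rule tendsto_uniform_limit_compose[where F = "\<lambda>n. f (\<sigma> (\<kappa> n))" and f = p, OF _ _ lim _ ev])
        show "uniform_limit (cball (g x) d) (\<lambda>n. f (\<sigma> (\<kappa> n))) p sequentially"
          using ul_p' d by simp
        show "continuous_on (cball (g x) d) p"
          using holp d(2) by (meson continuous_on_subset holomorphic_on_imp_continuous_on)
      qed (use d in auto)
      moreover have "\<forall>\<^sub>F n in sequentially. f (\<sigma> (\<kappa> n)) (G (\<tau> n) x) = x"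
        using ev
      proof eventually_elim
        case (elim n)
        then have "norm (G (\<tau> n) x) < 1" using d(2) by auto
        then show ?case using G(4)[OF x, of "\<tau> n"] by (simp add: \<kappa>_def)
      qed
      ultimately have "(\<lambda>n. x) \<longlonglongrightarrow> p (g x)"
        by (rule Lim_transform_eventually)
      then show ?thesis by (simp add: LIMSEQ_const_iff)
    qed
    show ?thesis using holg g_lt gpz pg by (intro exI[of _ g]) auto
  qed
  \<comment> \<open>A constant map has no section over a disc with two points. Hurwitz's theorem
    below needs this.\<close>
  have nonconst: "\<not> p constant_on ball 0 1"
  proof
    assume c: "p constant_on ball 0 1"
    obtain r where r: "r > 0" "ball w0 r \<subseteq> D" using assms(1,2) open_contains_ball by metis
    then obtain g where g: "g ` ball w0 r \<subseteq> ball 0 1" "\<forall>x\<in>ball w0 r. p (g x) = x"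
      using branches[OF r(2), of 0] p0 by auto
    define x where "x = w0 + of_real (r / 2)"
    have x: "x \<in> ball w0 r" using r by (simp add: x_def dist_norm)
    have "p (g x) = p 0"
      using c g(1) x unfolding constant_on_def by (metis centre_in_ball image_subset_iff zero_less_one)
    then have "x = w0" using g(2) x p0 by simp
    then show False using r by (simp add: x_def)
  qed
  \<comment> \<open>The limit might a priori touch the boundary of \<open>D\<close>. A value outside
    \<open>D\<close> is omitted by every \<open>f n\<close>, so by Hurwitz's theorem the nonconstant
    limit omits it as well.\<close>
  have "p z \<in> D" if z: "z \<in> ball 0 1" for z
  proof (rule ccontr)
    assume "p z \<notin> D"
    have "(\<lambda>z'. p z' - p z) z \<noteq> 0"
    proof (rule Hurwitz_no_zeros[of "ball 0 1" "\<lambda>n z'. f (\<sigma> n) z' - p z" "\<lambda>z'. p z' - p z" z])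
      show "uniform_limit K (\<lambda>n z'. f (\<sigma> n) z' - p z) (\<lambda>z'. p z' - p z) sequentially"
        if "compact K" "K \<subseteq> ball 0 1" for K
        using ul_p[OF that] by (intro uniform_limit_intros) (simp add: o_def)
      show "\<not> (\<lambda>z'. p z' - p z) constant_on ball 0 1"
        using nonconst unfolding constant_on_def by (metis diff_add_cancel)
      show "f (\<sigma> n) z' - p z \<noteq> 0" if "z' \<in> ball 0 1" for n z'
        using into[of z' "\<sigma> n"] that \<open>p z \<notin> D\<close> by auto
    qed (use z hol holp in \<open>auto intro!: holomorphic_intros\<close>)
    then show False by simp
  qed
  then have "branch_map p (ball 0 1) D"
    unfolding branch_map_def using holp branches by auto
  then show ?thesis using that p0 by blast
qed

text \<open>\<open>D\<close> is exhausted by its intersections with the discs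
  \<open>ball w0 (n + 1)\<close>. For each of them there is a branch map defined on nearly the whole
  disc, and rescaling makes it defined on all of it. The hypothesis on derivatives, used on the
  largest disc about \<open>z\<close> in the unit disc, gives the estimate that normality
  requires.\<close>

lemma disc_covering_exists:
  assumes D: "open D" "w0 \<in> D"
    and bd: "\<And>f z R. R > 0 \<Longrightarrow> f holomorphic_on ball z R \<Longrightarrow> f ` ball z R \<subseteq> D \<Longrightarrow> norm (deriv f z) * R \<le> C"
  obtains p where "branch_map p (ball 0 1) D" "p 0 = w0"
proof -
  \<comment> \<open>Equivalently \<open>c n = (n + 1) / (n + 2)\<close>, so that undoing the
    rescaling enlarges the disc to radius exactly \<open>1 + 1 / (n + 1)\<close>.\<close>
  define c where "c n = 1 - 1 / (real n + 2)" for n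
  have c: "0 < c n" "c n < 1" "1 / c n = 1 + 1 / (real n + 1)" for n
    by (auto simp: c_def divide_simps algebra_simps)
  have "\<exists>F U. branch_map F U (D \<inter> ball w0 (real n + 1)) \<and> F 0 = w0 \<and> ball 0 (c n) \<subseteq> U" for n
  proof -
    have o: "open (D \<inter> ball w0 (real n + 1))" using D by blast
    have m: "w0 \<in> D \<inter> ball w0 (real n + 1)" using D by simp
    have b: "bounded (D \<inter> ball w0 (real n + 1))" by blast
    have e: "1 / (real n + 2) > 0" by simp
    show ?thesis
      using branch_map_bounded_exists[OF o m b e] unfolding c_def by metis
  qed
  then obtain F U where F: "\<And>n. branch_map (F n) (U n) (D \<inter> ball w0 (real n + 1))"
    "\<And>n. F n 0 = w0" "\<And>n. ball 0 (c n) \<subseteq> U n" by metis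
  define f where "f n z = F n (of_real (c n) * z)" for n z
  have cz: "of_real (c n) * z \<in> U n" if "norm z < 1" for n z
  proof -
    have "norm (of_real (c n) * z) < c n" using that c(1)[of n] by (simp add: norm_mult)
    then show ?thesis using F(3)[of n] by auto
  qed
  have hol: "f n holomorphic_on ball 0 1" for n
  proof -
    have "(F n \<circ> (\<lambda>z. of_real (c n) * z)) holomorphic_on ball 0 1"
      by (rule holomorphic_on_compose_gen[OF _ branch_mapD(3)[OF F(1)]])
         (use cz in \<open>auto intro!: holomorphic_intros\<close>)
    then show ?thesis by (simp add: f_def[abs_def] o_def)
  qed
  have into: "f n z \<in> D" if "norm z < 1" for n z
    using branch_mapD(4)[OF F(1)[of n]] cz[OF that, of n] unfolding f_def by blast
  show ?thesis
  proof (rule covering_limit[OF D hol into])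
    show "f n 0 = w0" for n by (simp add: f_def F(2))
    show "norm (deriv (f n) z) * (1 - norm z) \<le> C" if z: "norm z < 1" for n z
    proof (rule bd)
      have sub: "ball z (1 - norm z) \<subseteq> ball 0 1"
      proof
        fix x assume "x \<in> ball z (1 - norm z)"
        then have "norm (x - z) < 1 - norm z" by (simp add: dist_norm norm_minus_commute)
        then have "norm x < 1" using norm_triangle_sub[of x z] by linarith
        then show "x \<in> ball 0 1" by simp
      qed
      show "f n holomorphic_on ball z (1 - norm z)" using hol sub by (rule holomorphic_on_subset)
      show "f n ` ball z (1 - norm z) \<subseteq> D" using into sub by auto
    qed (use z in simp)
    fix w r assume wr: "ball w r \<subseteq> D"
    obtain N :: nat where N: "dist w0 w + r \<le> real N" using real_arch_simple by blast
    show "\<exists>N. \<forall>n\<ge>N. \<forall>z. norm z < 1 \<longrightarrow> f n z \<in> ball w r \<longrightarrow>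
        (\<exists>g. g holomorphic_on ball w r \<and> (\<forall>x\<in>ball w r. norm (g x) < 1 + 1 / (real n + 1)) \<and>
             g (f n z) = z \<and> (\<forall>x\<in>ball w r. norm (g x) < 1 \<longrightarrow> f n (g x) = x))"
    proof (intro exI[of _ N] allI impI)
      fix n z assume n: "N \<le> n" and z: "norm (z::complex) < 1" and fz: "f n z \<in> ball w r"
      have "ball w r \<subseteq> ball w0 (real n + 1)"
      proof
        fix x assume "x \<in> ball w r"
        then have "dist w0 x < dist w0 w + r" using dist_triangle[of w0 x w] by simp
        then show "x \<in> ball w0 (real n + 1)" using N n by simp
      qed
      then have sub: "ball w r \<subseteq> D \<inter> ball w0 (real n + 1)" using wr by blast
      obtain g where g: "g holomorphic_on ball w r" "g ` ball w r \<subseteq> U n"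
          "g (F n (of_real (c n) * z)) = of_real (c n) * z" "\<And>x. x \<in> ball w r \<Longrightarrow> F n (g x) = x"
        using branch_mapE[OF F(1) sub cz[OF z] fz[unfolded f_def]] by blast
      show "\<exists>g. g holomorphic_on ball w r \<and> (\<forall>x\<in>ball w r. norm (g x) < 1 + 1 / (real n + 1)) \<and>
             g (f n z) = z \<and> (\<forall>x\<in>ball w r. norm (g x) < 1 \<longrightarrow> f n (g x) = x)"
      proof (intro exI[of _ "\<lambda>x. g x / of_real (c n)"] conjI ballI impI)
        show "(\<lambda>x. g x / of_real (c n)) holomorphic_on ball w r"
          using g(1) c(1)[of n] by (auto intro!: holomorphic_intros)
        show "g (f n z) / of_real (c n) = z" using g(3) c(1)[of n] by (simp add: f_def)
        fix x assume x: "x \<in> ball w r"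
        have "g x \<in> ball 0 1" using g(2) x branch_mapD(2)[OF F(1)[of n]] by blast
        then have "norm (g x / of_real (c n)) < 1 / c n"
          using c(1)[of n] by (simp add: norm_divide divide_strict_right_mono)
        then show "norm (g x / of_real (c n)) < 1 + 1 / (real n + 1)" by (simp add: c(3))
        show "f n (g x / of_real (c n)) = x" using g(4)[OF x] c(1)[of n] by (simp add: f_def)
      qed
    qed
  qed (assumption, rule that)
qed

section \<open>Comparison of coverings and the hyperbolic density\<close>

text \<open>Schwarz's lemma for \<open>A \<circ> g \<circ> B\<close>, where \<open>B\<close> moves 0
  to \<open>z\<close> and \<open>A\<close> moves \<open>g z\<close> to 0.\<close>

lemma Schwarz_Pick_deriv:
  assumes holg: "g holomorphic_on ball 0 1" and g1: "\<And>z. norm z < 1 \<Longrightarrow> norm (g z) < 1"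
    and z: "norm z < 1"
  shows "norm (deriv g z) * (1 - (norm z)\<^sup>2) \<le> 1 - (norm (g z))\<^sup>2"
proof -
  define A B where "A = Moebius_function 0 (g z)" and "B = Moebius_function 0 (- z)"
  have A1: "norm (A x) < 1" if "norm x < 1" for x
    unfolding A_def using that g1[OF z] by (rule Moebius_function_norm_lt_1[rotated])
  have B1: "norm (B x) < 1" if "norm x < 1" for x
    unfolding B_def using that z by (intro Moebius_function_norm_lt_1) auto
  have holA: "A holomorphic_on ball 0 1" and holB: "B holomorphic_on ball 0 1"
    unfolding A_def B_def using z g1[OF z] by (auto intro!: Moebius_function_holomorphic)
  define h where "h = A \<circ> g \<circ> B"
  have "g \<circ> B holomorphic_on ball 0 1"
    by (rule holomorphic_on_compose_gen[OF holB holg]) (use B1 in auto)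
  then have holh: "h holomorphic_on ball 0 1" unfolding h_def o_assoc[symmetric]
    by (rule holomorphic_on_compose_gen[OF _ holA]) (use B1 g1 in auto)
  have B0: "B 0 = z" by (simp add: B_def Moebius_function_of_zero)
  have h0: "h 0 = 0" by (simp add: h_def B0 A_def Moebius_function_eq_zero)
  have "norm (deriv h 0) \<le> 1"
    by (rule Schwarz_Lemma(2)[OF holh h0, of 0]) (use A1 g1 B1 in \<open>auto simp: h_def\<close>)
  moreover have "(h has_field_derivative
      of_real (1 / (1 - (norm (g z))\<^sup>2)) * (deriv g z * of_real (1 - (norm z)\<^sup>2))) (at 0)"
  proof -
    have dB: "(B has_field_derivative of_real (1 - (norm z)\<^sup>2)) (at 0)"
      using Moebius_function_has_derivative[of "-z" 0] z unfolding B_def by simp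
    have dg: "(g has_field_derivative deriv g z) (at (B 0))"
      unfolding B0 by (rule holomorphic_derivI[OF holg]) (use z in auto)
    have "1 - cnj (g z) * g z = of_real (1 - (norm (g z))\<^sup>2)"
      using complex_norm_square[of "g z"] by (simp add: mult.commute)
    moreover have "1 - (norm (g z))\<^sup>2 \<noteq> 0"
      using g1[OF z] abs_square_less_1[of "norm (g z)"] by simp
    moreover have "complex_of_real N / (complex_of_real N)\<^sup>2 = of_real (1 / N)" if "N \<noteq> 0" for N
      using that by (simp add: power2_eq_square)
    ultimately have dA: "(A has_field_derivative of_real (1 / (1 - (norm (g z))\<^sup>2))) (at (g (B 0)))"
      using Moebius_function_has_derivative[OF g1[OF z] g1[OF z]] unfolding A_def B0 by metis
    from DERIV_chain2[OF dA DERIV_chain2[OF dg dB]] show ?thesis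
      by (simp only: h_def o_def)
  qed
  ultimately have *: "norm (of_real (1 / (1 - (norm (g z))\<^sup>2)) * (deriv g z * of_real (1 - (norm z)\<^sup>2))) \<le> 1"
    by (simp only: DERIV_imp_deriv)
  have p1: "1 - (norm (g z))\<^sup>2 > 0" using g1[OF z] abs_square_less_1[of "norm (g z)"] by simp
  have p2: "1 - (norm z)\<^sup>2 > 0" using z abs_square_less_1[of "norm z"] by simp
  have "1 / (1 - (norm (g z))\<^sup>2) * (norm (deriv g z) * (1 - (norm z)\<^sup>2)) \<le> 1"
    using * p1 p2 by (simp only: norm_mult norm_of_real abs_of_pos zero_less_divide_1_iff)
  then show ?thesis using p1 by (simp add: field_simps)
qed

lemma holomorphic_covering_local_inverse:
  assumes hol: "p holomorphic_on S" and S: "open S" and cov: "covering_space S p D" and x: "x \<in> S"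
  obtains T k where "open T" "x \<in> T" "T \<subseteq> S" "inj_on p T" "k holomorphic_on p ` T" "\<And>y. y \<in> T \<Longrightarrow> k (p y) = y"
proof -
  obtain T u q where T: "x \<in> T" "openin (top_of_set S) T" "homeomorphism T u p q"
    using covering_space_local_homeomorphism[OF cov x] by metis
  have T': "open T" "T \<subseteq> S" using T(2) S openin_open_eq by blast+
  have inj: "inj_on p T" using T(3) by (metis homeomorphism_apply1 inj_on_inverseI)
  obtain k where "k holomorphic_on p ` T" "\<And>y. y \<in> T \<Longrightarrow> k (p y) = y"
    using holomorphic_has_inverse[OF holomorphic_on_subset[OF hol T'(2)] T'(1) inj] by metis
  then show ?thesis using that T T' inj by blast
qed

lemma holomorphic_covering_deriv_nonzero:
  assumes "holomorphic_universal_covering p D" "norm z < 1"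
  shows "deriv p z \<noteq> 0"
proof -
  have p: "p holomorphic_on ball 0 1" "covering_space (ball 0 1) p D"
    using assms unfolding holomorphic_universal_covering_def by auto
  have "z \<in> ball 0 1" using assms by simp
  from holomorphic_covering_local_inverse[OF p(1) open_ball p(2) this]
  obtain T where "open T" "z \<in> T" "T \<subseteq> ball 0 1" "inj_on p T" by metis
  then show ?thesis using p(1)
    by (meson holomorphic_injective_imp_regular holomorphic_on_subset)
qed

text \<open>Lifting \<open>p\<close> through \<open>q\<close> gives a self-map \<open>g\<close> of
  the disc with \<open>p = q \<circ> g\<close> and \<open>g z = y\<close>, to which the Schwarz-Pick
  inequality applies. Exchanging the roles of \<open>p\<close> and \<open>q\<close> yields
  equality.\<close>

lemma covering_deriv_le:
  assumes p: "holomorphic_universal_covering p D" and q: "holomorphic_universal_covering q D"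
    and z: "norm z < 1" and y: "norm y < 1" and eq: "p z = q y"
  shows "norm (deriv p z) * (1 - (norm z)\<^sup>2) \<le> norm (deriv q y) * (1 - (norm y)\<^sup>2)"
proof -
  have p': "p holomorphic_on ball 0 1" "covering_space (ball 0 1) p D"
    and q': "q holomorphic_on ball 0 1" "covering_space (ball 0 1) q D"
    using p q unfolding holomorphic_universal_covering_def by auto
  have zb: "z \<in> ball 0 1" and yb: "y \<in> ball 0 1" using z y by auto
  have sc: "simply_connected (ball (0::complex) 1)" and lp: "locally path_connected (ball (0::complex) 1)"
    by (auto intro: convex_imp_simply_connected convex_imp_locally_path_connected)
  obtain g where contg: "continuous_on (ball 0 1) g" and g1: "g \<in> ball 0 1 \<rightarrow> ball 0 1" and gz: "g z = y"
    and qg: "\<And>x. x \<in> ball 0 1 \<Longrightarrow> q (g x) = p x"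
  proof (rule covering_space_lift_strong[where f = p, OF q'(2) yb zb sc lp _ _ eq])
    show "continuous_on (ball 0 1) p" using p'(1) by (rule holomorphic_on_imp_continuous_on)
    show "p \<in> ball 0 1 \<rightarrow> D" using covering_space_imp_surjective[OF p'(2)] by blast
  qed (rule that)
  have holg: "g holomorphic_on ball 0 1"
  proof -
    \<comment> \<open>Topology provides only a continuous lift. Locally it equals
      \<open>k \<circ> p\<close> with a holomorphic local inverse \<open>k\<close> of
      \<open>q\<close>, hence it is holomorphic.\<close>
    have "g field_differentiable at x" if x: "x \<in> ball 0 1" for x
    proof -
      have gx: "g x \<in> ball 0 1" using g1 x by blast
      obtain T k where T: "open T" "g x \<in> T" "T \<subseteq> ball 0 1" "inj_on q T" "k holomorphic_on q ` T"
        "\<And>y. y \<in> T \<Longrightarrow> k (q y) = y"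
        using holomorphic_covering_local_inverse[OF q'(1) open_ball q'(2) gx] by metis
      define W where "W = ball 0 1 \<inter> g -` T"
      have W: "open W" "x \<in> W" "W \<subseteq> ball 0 1"
        unfolding W_def using contg T x by (auto intro: continuous_open_preimage)
      have "(k \<circ> p) holomorphic_on W"
      proof (rule holomorphic_on_compose_gen[OF _ T(5)])
        show "p holomorphic_on W" using p'(1) W(3) by (rule holomorphic_on_subset)
        show "p ` W \<subseteq> q ` T"
        proof
          fix y assume "y \<in> p ` W"
          then obtain v where v: "v \<in> W" "y = p v" by blast
          then have "y = q (g v)" "g v \<in> T" using qg[of v] by (simp_all add: W_def)
          then show "y \<in> q ` T" by blast
        qed
      qed
      then have "g holomorphic_on W"
      proof (rule holomorphic_transform)
        fix v assume "v \<in> W"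
        then have "g v \<in> T" "q (g v) = p v" using qg[of v] by (simp_all add: W_def)
        then show "(k \<circ> p) v = g v" using T(6)[of "g v"] by simp
      qed
      then show ?thesis using W holomorphic_on_imp_differentiable_at by blast
    qed
    then show ?thesis by (simp add: holomorphic_on_def field_differentiable_at_within)
  qed
  have g1': "norm (g x) < 1" if "norm x < 1" for x using g1 that by auto
  have dg: "(g has_field_derivative deriv g z) (at z)"
    by (rule holomorphic_derivI[OF holg open_ball zb])
  have dq: "(q has_field_derivative deriv q y) (at (g z))"
    unfolding gz by (rule holomorphic_derivI[OF q'(1) open_ball yb])
  have "((\<lambda>x. q (g x)) has_field_derivative deriv q y * deriv g z) (at z)"
    by (rule DERIV_chain2[OF dq dg])
  then have "(p has_field_derivative deriv q y * deriv g z) (at z)"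
    by (rule has_field_derivative_transform_within_open[of _ _ _ "ball 0 1"]) (use zb qg in auto)
  then have "deriv p z = deriv q y * deriv g z" by (rule DERIV_imp_deriv)
  then have "norm (deriv p z) * (1 - (norm z)\<^sup>2) = norm (deriv q y) * (norm (deriv g z) * (1 - (norm z)\<^sup>2))"
    by (simp add: norm_mult)
  also have "\<dots> \<le> norm (deriv q y) * (1 - (norm y)\<^sup>2)"
    using Schwarz_Pick_deriv[OF holg g1' z] unfolding gz by (intro mult_left_mono) auto
  finally show ?thesis .
qed

text \<open>This justifies the definite description: the comparison in both directions gives
  existence, and since a covering has nonzero derivative, any one covering determines the
  value.\<close>

lemma hyperbolic_density_eq:
  assumes p: "holomorphic_universal_covering p D" and z: "norm z < 1"
  shows "hyperbolic_density D (p z) = 2 / ((1 - (norm z)\<^sup>2) * norm (deriv p z))"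
  unfolding hyperbolic_density_def
proof (rule the_equality)
  have pos: "1 - (norm y)\<^sup>2 > 0" if "norm y < 1" for y :: complex
    using that abs_square_less_1[of "norm y"] by simp
  have nz: "norm (deriv p z) > 0" using holomorphic_covering_deriv_nonzero[OF p z] by simp
  show "\<forall>q y. holomorphic_universal_covering q D \<longrightarrow> y \<in> ball 0 1 \<longrightarrow> q y = p z \<longrightarrow>
      2 / ((1 - (norm z)\<^sup>2) * norm (deriv p z)) * norm (deriv q y) = 2 / (1 - (norm y)\<^sup>2)"
  proof (intro allI impI)
    fix q y assume q: "holomorphic_universal_covering q D" and "y \<in> ball 0 1" and qy: "q y = p z"
    then have y: "norm y < 1" by simp
    have "norm (deriv p z) * (1 - (norm z)\<^sup>2) = norm (deriv q y) * (1 - (norm y)\<^sup>2)"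
      using covering_deriv_le[OF p q z y] covering_deriv_le[OF q p y z] qy by simp
    then show "2 / ((1 - (norm z)\<^sup>2) * norm (deriv p z)) * norm (deriv q y) = 2 / (1 - (norm y)\<^sup>2)"
      using pos[OF z] pos[OF y] nz by (simp add: field_simps)
  qed
  fix l assume "\<forall>q y. holomorphic_universal_covering q D \<longrightarrow> y \<in> ball 0 1 \<longrightarrow> q y = p z \<longrightarrow>
      l * norm (deriv q y) = 2 / (1 - (norm y)\<^sup>2)"
  then have "l * norm (deriv p z) = 2 / (1 - (norm z)\<^sup>2)" using p z by simp
  then show "l = 2 / ((1 - (norm z)\<^sup>2) * norm (deriv p z))"
    using pos[OF z] nz by (simp add: field_simps)
qed

text \<open>A covering is later chosen anew for each point, with the centre over that point, so only
  this case of the formula is needed for the estimates.\<close>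

lemma hyperbolic_density_at_base:
  assumes "open D" "connected D" "branch_map p (ball 0 1) D"
  shows "hyperbolic_density D (p 0) = 2 / norm (deriv p 0)" "deriv p 0 \<noteq> 0"
  using hyperbolic_density_eq[of p D 0] holomorphic_covering_deriv_nonzero[of p D 0]
    branch_map_disc_covering[OF assms(3,1,2)] by simp_all

text \<open>Near \<open>p 0\<close> an inverse branch \<open>g\<close> turns the density into an
  explicit expression in \<open>g\<close> and \<open>deriv p\<close>, whose denominator does not
  vanish.\<close>

lemma isCont_hyperbolic_density:
  assumes D: "open D" "connected D" and p: "branch_map p (ball 0 1) D"
  shows "isCont (hyperbolic_density D) (p 0)"
proof -
  have cov: "holomorphic_universal_covering p D" by (rule branch_map_disc_covering[OF p D])
  have "p 0 \<in> D" using branch_mapD(4)[OF p] by auto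
  then obtain r where r: "r > 0" "ball (p 0) r \<subseteq> D" using D(1) open_contains_ball by metis
  then have p0: "p 0 \<in> ball (p 0) r" by simp
  obtain g where g: "g holomorphic_on ball (p 0) r" "g ` ball (p 0) r \<subseteq> ball 0 1"
      "\<And>x. x \<in> ball (p 0) r \<Longrightarrow> p (g x) = x"
    using branch_mapE[OF p r(2) _ p0] by (metis centre_in_ball zero_less_one)
  have dens: "hyperbolic_density D x = 2 / ((1 - (norm (g x))\<^sup>2) * norm (deriv p (g x)))"
    if x: "x \<in> ball (p 0) r" for x
  proof -
    have "g x \<in> ball 0 1" using g(2) x by blast
    then have "norm (g x) < 1" by simp
    from hyperbolic_density_eq[OF cov this] show ?thesis by (simp only: g(3)[OF x])
  qed
  have "g (p 0) \<in> ball 0 1" using g(2) p0 by blast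
  then have g0: "norm (g (p 0)) < 1" by simp
  have cg: "isCont g (p 0)"
    using g(1) p0 by (meson continuous_on_eq_continuous_at holomorphic_on_imp_continuous_on open_ball)
  have "isCont (deriv p) (g (p 0))"
  proof -
    have "deriv p holomorphic_on ball 0 1" by (rule holomorphic_deriv[OF branch_mapD(3)[OF p] open_ball])
    then show ?thesis using g0
      by (metis continuous_on_eq_continuous_at holomorphic_on_imp_continuous_on open_ball mem_ball_0)
  qed
  then have "isCont (\<lambda>x. deriv p (g x)) (p 0)" by (rule isCont_o2[OF cg])
  moreover have "(norm (g (p 0)))\<^sup>2 \<noteq> 1" using g0 abs_square_less_1[of "norm (g (p 0))"] by simp
  moreover have "deriv p (g (p 0)) \<noteq> 0" by (rule holomorphic_covering_deriv_nonzero[OF cov g0])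
  ultimately have c: "isCont (\<lambda>x. 2 / ((1 - (norm (g x))\<^sup>2) * norm (deriv p (g x)))) (p 0)"
    using cg by (intro continuous_intros) auto
  have "\<forall>\<^sub>F x in nhds (p 0). hyperbolic_density D x = 2 / ((1 - (norm (g x))\<^sup>2) * norm (deriv p (g x)))"
    using dens p0 eventually_nhds open_ball by blast
  then show ?thesis using c by (subst isCont_cong)
qed

section \<open>Cauchy transforms and cone potentials\<close>

lemma ball_in_sets_borel [measurable]: "ball (w :: 'a :: metric_space) r \<in> sets borel"
  by simp

lemma nn_integral_ball_affine:
  fixes w :: complex
  assumes [measurable]: "h \<in> borel_measurable borel" and r: "r > 0"
  shows "(\<integral>\<^sup>+x\<in>ball w r. h (x - w) \<partial>lborel) = ennreal (r\<^sup>2) * (\<integral>\<^sup>+x\<in>ball 0 1. h (r *\<^sub>R x) \<partial>lborel)"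
proof -
  define F where "F x = h (x - w) * indicator (ball w r) x" for x
  have [measurable]: "F \<in> borel_measurable borel" unfolding F_def by measurable
  have "(\<integral>\<^sup>+x\<in>ball w r. h (x - w) \<partial>lborel) =
      (\<integral>\<^sup>+x. F x \<partial>density (distr lborel borel (\<lambda>x. w + r *\<^sub>R x)) (\<lambda>_. \<bar>r\<bar> ^ DIM(complex)))"
    using lborel_affine[of r w] r by (simp add: F_def)
  also have "\<dots> = (\<integral>\<^sup>+x. ennreal (r\<^sup>2) * F (w + r *\<^sub>R x) \<partial>lborel)"
    using r by (simp add: nn_integral_density nn_integral_distr)
  also have "\<dots> = (\<integral>\<^sup>+x. ennreal (r\<^sup>2) * (h (r *\<^sub>R x) * indicator (ball w r) (w + r *\<^sub>R x)) \<partial>lborel)"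
    by (simp add: F_def)
  also have "\<dots> = ennreal (r\<^sup>2) * (\<integral>\<^sup>+x. h (r *\<^sub>R x) * indicator (ball w r) (w + r *\<^sub>R x) \<partial>lborel)"
    by (rule nn_integral_cmult) measurable
  also have "(\<lambda>x. indicator (ball w r) (w + r *\<^sub>R x) :: ennreal) = indicator (ball 0 1)"
    using r by (auto simp: fun_eq_iff indicator_def dist_norm)
  finally show ?thesis .
qed

text \<open>A dyadic substitute for polar coordinates: \<open>1 / norm x\<close> is at most
  \<open>2 ^ (k + 1)\<close> on a suitable disc of radius \<open>2 ^ - k\<close>, whose area is of
  order \<open>4 ^ - k\<close>, so the sum is geometric. The origin contributes nothing, as
  \<open>1 / 0 = 0\<close>.\<close>

lemma nn_integral_inverse_norm_finite:
  "(\<integral>\<^sup>+x\<in>ball 0 1. ennreal (1 / norm (x::complex)) \<partial>lborel) < \<infinity>"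
proof -
  define B where "B k = ball (0::complex) ((1/2) ^ k)" for k :: nat
  have "(\<integral>\<^sup>+x\<in>ball 0 1. ennreal (1 / norm (x::complex)) \<partial>lborel) \<le>
      (\<integral>\<^sup>+x. (\<Sum>k. ennreal (2 ^ Suc k) * indicator (B k) x) \<partial>lborel)"
  proof (rule nn_integral_mono)
    fix x :: complex
    show "ennreal (1 / norm x) * indicator (ball 0 1) x \<le> (\<Sum>k. ennreal (2 ^ Suc k) * indicator (B k) x)"
    proof (cases "x \<in> ball 0 1 \<and> x \<noteq> 0")
      case True
      then have x: "0 < norm x" "norm x < 1" by auto
      have "\<exists>n. (1/2) ^ n \<le> norm x"
        using real_arch_pow_inv[OF x(1), of "1/2"] by (auto intro: less_imp_le)
      moreover have "\<not> (1/2) ^ 0 \<le> norm x" using x by simp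
      ultimately obtain k where k: "\<not> (1/2) ^ k \<le> norm x" "(1/2) ^ Suc k \<le> norm x"
        using exists_least_lemma[of "\<lambda>n. (1/2) ^ n \<le> norm x"] by blast
      have "1 / norm x \<le> 1 / (1/2) ^ Suc k" using k(2) x by (intro divide_left_mono) auto
      then have "ennreal (1 / norm x) \<le> ennreal (2 ^ Suc k)"
        by (intro ennreal_leI) (simp add: power_one_over)
      then have "ennreal (1 / norm x) * indicator (ball 0 1) x \<le> ennreal (2 ^ Suc k) * indicator (B k) x"
        using k(1) True by (simp add: B_def)
      also have "\<dots> \<le> (\<Sum>k. ennreal (2 ^ Suc k) * indicator (B k) x)"
        using sum_le_suminf[of a "{k}" for a :: "nat \<Rightarrow> ennreal", simplified] by this
      finally show ?thesis .
    qed (auto simp: indicator_def)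
  qed
  also have "\<dots> = (\<Sum>k. (\<integral>\<^sup>+x. ennreal (2 ^ Suc k) * indicator (B k) x \<partial>lborel))"
    by (rule nn_integral_suminf) (simp add: B_def)
  also have "\<dots> = (\<Sum>k. ennreal (2 * unit_ball_vol 2 * (1/2) ^ k))"
  proof (rule suminf_cong)
    fix k
    have "(\<integral>\<^sup>+x. ennreal (2 ^ Suc k) * indicator (B k) x \<partial>lborel) = ennreal (2 ^ Suc k) * emeasure lborel (B k)"
      by (rule nn_integral_cmult_indicator) (simp add: B_def)
    also have "\<dots> = ennreal (2 ^ Suc k) * ennreal (unit_ball_vol 2 * ((1/2) ^ k)\<^sup>2)"
      by (simp add: B_def emeasure_ball)
    also have "\<dots> = ennreal (2 ^ Suc k * (unit_ball_vol 2 * ((1/2) ^ k)\<^sup>2))"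
      by (rule ennreal_mult[symmetric]) auto
    also have "2 ^ Suc k * (unit_ball_vol 2 * ((1/2) ^ k)\<^sup>2) = 2 * unit_ball_vol 2 * (1/2 :: real) ^ k"
      by (simp add: power2_eq_square power_one_over field_simps)
    finally show "(\<integral>\<^sup>+x. ennreal (2 ^ Suc k) * indicator (B k) x \<partial>lborel) = ennreal (2 * unit_ball_vol 2 * (1/2) ^ k)" .
  qed
  also have "\<dots> = ennreal (\<Sum>k. 2 * unit_ball_vol 2 * (1/2) ^ k)"
    by (rule suminf_ennreal2) (auto intro!: summable_mult)
  also have "\<dots> < \<infinity>" by simp
  finally show ?thesis .
qed

text \<open>The value is 2 pi, but only that it is finite and nonnegative will matter.\<close>

definition newton_const :: real where
  "newton_const = enn2real (\<integral>\<^sup>+x\<in>ball 0 1. ennreal (1 / norm (x::complex)) \<partial>lborel)"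

lemma newton_const_nonneg: "newton_const \<ge> 0" by (simp add: newton_const_def)

lemma nn_integral_inverse_norm_ball:
  assumes r: "r > 0"
  shows "(\<integral>\<^sup>+x\<in>ball w r. ennreal (1 / norm (x - w :: complex)) \<partial>lborel) = ennreal (newton_const * r)"
proof -
  have fin: "(\<integral>\<^sup>+x\<in>ball 0 1. ennreal (1 / norm (x::complex)) \<partial>lborel) = ennreal newton_const"
    using nn_integral_inverse_norm_finite by (simp add: newton_const_def)
  have "(\<integral>\<^sup>+x\<in>ball w r. ennreal (1 / norm (x - w :: complex)) \<partial>lborel)
      = ennreal (r\<^sup>2) * (\<integral>\<^sup>+x\<in>ball 0 1. ennreal (1 / norm (r *\<^sub>R x :: complex)) \<partial>lborel)"
    by (rule nn_integral_ball_affine[OF _ r]) measurable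
  also have "(\<integral>\<^sup>+x\<in>ball 0 1. ennreal (1 / norm (r *\<^sub>R x :: complex)) \<partial>lborel)
     = (\<integral>\<^sup>+x. ennreal (1 / r) * (ennreal (1 / norm x) * indicator (ball 0 1) x) \<partial>(lborel :: complex measure))"
    using r by (intro nn_integral_cong) (simp add: mult.assoc[symmetric] ennreal_mult[symmetric])
  also have "\<dots> = ennreal (1 / r) * ennreal newton_const"
    unfolding fin[symmetric] by (rule nn_integral_cmult) measurable
  also have "ennreal (r\<^sup>2) * (ennreal (1 / r) * ennreal newton_const) = ennreal (newton_const * r)"
    using r newton_const_nonneg by (simp add: ennreal_mult[symmetric] power2_eq_square)
  finally show ?thesis .
qed

text \<open>The integral is split at distance \<open>r\<close> from \<open>z\<close>: the near part
  is at most the integral over the full disc, and on the far part the integrand is at most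
  \<open>1 / r\<close>. The bound is uniform in \<open>z\<close>.\<close>

lemma inverse_norm_integral:
  fixes E :: "complex set"
  assumes [measurable]: "E \<in> sets borel" and fin: "emeasure lborel E < \<infinity>" and r: "r > 0"
  shows "set_integrable lborel E (\<lambda>x. 1 / norm (x - z))"
    and "(LINT x:E|lborel. 1 / norm (x - z)) \<le> newton_const * r + measure lborel E / r"
proof -
  have "(\<integral>\<^sup>+x. ennreal (indicator E x * (1 / norm (x - z))) \<partial>lborel) \<le>
     (\<integral>\<^sup>+x. (ennreal (1 / norm (x - z)) * indicator (ball z r) x + ennreal (1 / r) * indicator E x) \<partial>lborel)"
  proof (rule nn_integral_mono)
    fix x
    show "ennreal (indicator E x * (1 / norm (x - z))) \<le>
        ennreal (1 / norm (x - z)) * indicator (ball z r) x + ennreal (1 / r) * indicator E x"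
    proof (cases "x \<in> ball z r")
      case True
      then show ?thesis by (simp add: indicator_def add_increasing2)
    next
      case False
      then have "r \<le> norm (x - z)" by (simp add: dist_norm norm_minus_commute)
      then have "1 / norm (x - z) \<le> 1 / r" using r by (simp add: frac_le)
      then show ?thesis using False by (auto simp: indicator_def intro!: ennreal_leI)
    qed
  qed
  also have "\<dots> = ennreal (newton_const * r) + ennreal (1 / r) * emeasure lborel E"
    by (subst nn_integral_add) (simp_all add: nn_integral_inverse_norm_ball r nn_integral_cmult_indicator)
  also have "\<dots> = ennreal (newton_const * r + measure lborel E / r)"
    using fin r newton_const_nonneg
    by (simp add: emeasure_eq_ennreal_measure ennreal_mult[symmetric] ennreal_plus[symmetric] del: ennreal_plus)
  finally have le: "(\<integral>\<^sup>+x. ennreal (indicator E x * (1 / norm (x - z))) \<partial>lborel)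
     \<le> ennreal (newton_const * r + measure lborel E / r)" .
  show int: "set_integrable lborel E (\<lambda>x. 1 / norm (x - z))"
    unfolding set_integrable_def real_scaleR_def
  proof (rule integrableI_nonneg)
    show "(\<integral>\<^sup>+x. ennreal (indicator E x * (1 / norm (x - z))) \<partial>lborel) < \<infinity>"
      using le by (metis ennreal_less_top infinity_ennreal_def le_less_trans)
  qed auto
  have "ennreal (LINT x:E|lborel. 1 / norm (x - z)) = (\<integral>\<^sup>+x. ennreal (indicator E x * (1 / norm (x - z))) \<partial>lborel)"
    using int unfolding set_lebesgue_integral_def set_integrable_def real_scaleR_def
    by (intro nn_integral_eq_integral[symmetric]) auto
  with le have "ennreal (LINT x:E|lborel. 1 / norm (x - z)) \<le> ennreal (newton_const * r + measure lborel E / r)"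
    by (simp only:)
  moreover have "0 \<le> newton_const * r + measure lborel E / r" using r newton_const_nonneg by simp
  ultimately show "(LINT x:E|lborel. 1 / norm (x - z)) \<le> newton_const * r + measure lborel E / r"
    by (simp only: ennreal_le_iff)
qed

section \<open>Cauchy transforms of sets of finite area\<close>

definition cauchy_transform :: "complex set \<Rightarrow> complex \<Rightarrow> complex" where
  "cauchy_transform E z = (LINT x:E|lborel. 1 / (z - x))"

lemma set_integrable_bounded:
  fixes f :: "complex \<Rightarrow> complex"
  assumes [measurable]: "E \<in> sets borel" "f \<in> borel_measurable borel" and fin: "emeasure lborel E < \<infinity>"
    and bd: "\<And>x. x \<in> E \<Longrightarrow> norm (f x) \<le> B"
  shows "set_integrable lborel E f" and "norm (LINT x:E|lborel. f x) \<le> B * measure lborel E"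
proof -
  have i: "integrable lborel (\<lambda>x. B * indicator E x :: real)"
    using fin by (intro integrable_mult_right integrable_real_indicator) auto
  show int: "set_integrable lborel E f" unfolding set_integrable_def
    by (rule Bochner_Integration.integrable_bound[OF i]) (use bd in \<open>auto simp: indicator_def intro!: AE_I2 intro: order_trans[OF _ abs_ge_self]\<close>)
  have "norm (LINT x:E|lborel. f x) \<le> (LINT x:E|lborel. norm (f x))"
    by (rule set_integral_norm_bound[OF int])
  also have "\<dots> \<le> (\<integral>x. B * indicator E x \<partial>lborel)"
    unfolding set_lebesgue_integral_def
    by (rule integral_mono[OF _ i])
      (use set_integrable_norm[OF int] bd in \<open>auto simp: set_integrable_def indicator_def\<close>)
  also have "\<dots> = B * measure lborel E" by simp
  finally show "norm (LINT x:E|lborel. f x) \<le> B * measure lborel E" .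
qed

lemma cauchy_transform_integrable:
  assumes [measurable]: "E \<in> sets borel" and fin: "emeasure lborel E < \<infinity>" and r: "r > 0"
  shows "set_integrable lborel E (\<lambda>x. 1 / (z - x))"
    and "norm (cauchy_transform E z) \<le> newton_const * r + measure lborel E / r"
proof -
  note i = inverse_norm_integral[OF assms, of z]
  show int: "set_integrable lborel E (\<lambda>x. 1 / (z - x))"
    unfolding set_integrable_def
    by (rule Bochner_Integration.integrable_bound[OF i(1)[unfolded set_integrable_def]])
       (auto simp: norm_divide norm_minus_commute)
  have "norm (cauchy_transform E z) \<le> (LINT x:E|lborel. norm (1 / (z - x)))"
    unfolding cauchy_transform_def by (rule set_integral_norm_bound[OF int])
  also have "\<dots> = (LINT x:E|lborel. 1 / norm (x - z))"
    by (simp add: norm_divide norm_minus_commute)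
  finally show "norm (cauchy_transform E z) \<le> newton_const * r + measure lborel E / r"
    using i(2) by linarith
qed

text \<open>The difference quotient minus the integral of the differentiated kernel is
  \<open>z - w\<close> times the integral of \<open>1 / ((w - x) ^ 2 * (z - x))\<close>. That kernel
  is bounded on \<open>E\<close>, because \<open>w\<close> has positive distance from
  \<open>E\<close>; so the error is of order \<open>norm (z - w)\<close>.\<close>

lemma cauchy_transform_holomorphic:
  assumes E [measurable]: "E \<in> sets borel" and fin: "emeasure lborel E < \<infinity>"
    and S: "open S" "S \<inter> E = {}"
  shows "cauchy_transform E holomorphic_on S"
  unfolding holomorphic_on_open[OF S(1)]
proof (intro ballI exI)
  fix w assume "w \<in> S"
  then obtain e where e: "e > 0" "ball w e \<subseteq> S" using S(1) open_contains_ball by metis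
  \<comment> \<open>Half the radius, so that every \<open>z\<close> within \<open>d\<close> of
    \<open>w\<close> still has distance at least \<open>d\<close> from \<open>E\<close>.\<close>
  define d where "d = e / 2"
  have d: "d > 0" using e by (simp add: d_def)
  have far_w: "d \<le> norm (w - x)" if "x \<in> E" for x
  proof -
    have "x \<notin> ball w e" using that S e by blast
    then show ?thesis using e by (simp add: d_def dist_norm)
  qed
  have far: "d \<le> norm (z - x)" if "x \<in> E" "norm (z - w) < d" for x z
  proof -
    have "x \<notin> ball w e" using that S e by blast
    then have "e \<le> norm (w - x)" by (simp add: dist_norm)
    moreover have "norm (w - x) \<le> norm (z - w) + norm (z - x)"
      using norm_triangle_ineq4[of "z - x" "z - w"] by simp
    ultimately show ?thesis using that by (simp add: d_def)
  qed
  define L where "L = (LINT x:E|lborel. - 1 / (w - x)\<^sup>2)"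
  have intL: "set_integrable lborel E (\<lambda>x. - 1 / (w - x)\<^sup>2)"
  proof (rule set_integrable_bounded(1)[OF E _ fin])
    show "norm (- 1 / (w - x)\<^sup>2) \<le> 1 / d\<^sup>2" if "x \<in> E" for x
      using far_w[OF that] d by (simp add: norm_divide norm_power frac_le power_mono)
  qed auto
  have est: "norm ((cauchy_transform E z - cauchy_transform E w) / (z - w) - L) \<le> norm (z - w) * (1 / d ^ 3 * measure lborel E)"
    if z: "norm (z - w) < d" "z \<noteq> w" for z
  proof -
    have ne: "z - x \<noteq> 0" "w - x \<noteq> 0" if "x \<in> E" for x using far[OF that z(1)] far_w[OF that] d by auto
    have "(z - w) * (LINT x:E|lborel. 1 / ((w - x)\<^sup>2 * (z - x))) = (LINT x:E|lborel. (z - w) * (1 / ((w - x)\<^sup>2 * (z - x))))"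
      by (rule set_integral_mult_right[symmetric])
    also have "\<dots> = (LINT x:E|lborel. (1 / (z - x) - 1 / (w - x)) / (z - w) - (- 1 / (w - x)\<^sup>2))"
    proof (rule set_lebesgue_integral_cong)
      have "(z - w) * (1 / ((w - x)\<^sup>2 * (z - x))) = (1 / (z - x) - 1 / (w - x)) / (z - w) - (- 1 / (w - x)\<^sup>2)" if "x \<in> E" for x
      proof -
        have zw: "z - w \<noteq> 0" using z by simp
        have "(1 / (z - x) - 1 / (w - x)) = - (z - w) / ((z - x) * (w - x))"
          using ne[OF that] by (simp add: divide_simps)
        then have "(1 / (z - x) - 1 / (w - x)) / (z - w) = - 1 / ((z - x) * (w - x))" using zw by (simp add: divide_simps)
        moreover have "- 1 / ((z - x) * (w - x)) - (- 1 / (w - x)\<^sup>2) = (z - w) * (1 / ((w - x)\<^sup>2 * (z - x)))"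
          using ne[OF that] by (simp add: divide_simps power2_eq_square)
        ultimately show ?thesis by simp
      qed
      then show "\<forall>x. x \<in> E \<longrightarrow> (z - w) * (1 / ((w - x)\<^sup>2 * (z - x))) = (1 / (z - x) - 1 / (w - x)) / (z - w) - (- 1 / (w - x)\<^sup>2)"
        by blast
    qed simp
    also have "\<dots> = (LINT x:E|lborel. (1 / (z - x) - 1 / (w - x)) / (z - w)) - L"
      unfolding L_def using cauchy_transform_integrable(1)[OF E fin d] intL
      by (intro set_integral_diff set_integrable_divide set_integral_diff(1)) auto
    also have "(LINT x:E|lborel. (1 / (z - x) - 1 / (w - x)) / (z - w)) = (cauchy_transform E z - cauchy_transform E w) / (z - w)"
      unfolding cauchy_transform_def
      using set_integral_diff(2)[OF cauchy_transform_integrable(1)[OF E fin d, of z] cauchy_transform_integrable(1)[OF E fin d, of w]]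
      by simp
    finally have eq: "(cauchy_transform E z - cauchy_transform E w) / (z - w) - L = (z - w) * (LINT x:E|lborel. 1 / ((w - x)\<^sup>2 * (z - x)))" ..
    have "norm (LINT x:E|lborel. 1 / ((w - x)\<^sup>2 * (z - x))) \<le> 1 / d ^ 3 * measure lborel E"
    proof (rule set_integrable_bounded(2)[OF E _ fin])
      fix x assume x: "x \<in> E"
      have "d\<^sup>2 * d \<le> norm (w - x) ^ 2 * norm (z - x)"
        using far_w[OF x] far[OF x z(1)] d by (intro mult_mono power_mono) auto
      then show "norm (1 / ((w - x)\<^sup>2 * (z - x))) \<le> 1 / d ^ 3"
        using d by (simp add: norm_divide norm_mult norm_power power3_eq_cube power2_eq_square frac_le)
    qed auto
    then show ?thesis unfolding eq norm_mult by (rule mult_left_mono) simp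
  qed
  show "(cauchy_transform E has_field_derivative L) (at w)"
    unfolding has_field_derivative_iff
  proof (rule LIM_zero_cancel, rule Lim_null_comparison)
    have "\<forall>\<^sub>F z in at w. dist z w < d \<and> z \<noteq> w" using d eventually_at by blast
    then show "\<forall>\<^sub>F z in at w. norm ((cauchy_transform E z - cauchy_transform E w) / (z - w) - L) \<le> norm (z - w) * (1 / d ^ 3 * measure lborel E)"
      by eventually_elim (rule est, auto simp: dist_norm)
    show "((\<lambda>z. norm (z - w) * (1 / d ^ 3 * measure lborel E)) \<longlongrightarrow> 0) (at w)"
      by (intro tendsto_mult_left_zero tendsto_norm_zero LIM_zero tendsto_ident_at)
  qed
qed

section \<open>The cone kernel and the derivative estimate\<close>

text \<open>
  On the cone of directions within 45 degrees of \<open>\<i> u\<close> this is the imaginary part of \<open>- u / z\<close>.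
  At the vertex \<open>z = 0\<close> its value is \<open>0 / 0 = 0\<close>.
\<close>

definition cone_kernel :: "complex \<Rightarrow> complex \<Rightarrow> real" where
  "cone_kernel u z = (if \<bar>Re (z / u)\<bar> \<le> Im (z / u) then Im (z / u) / (norm z)\<^sup>2 else 0)"

lemma cone_kernel_measurable [measurable]: "cone_kernel u \<in> borel_measurable borel"
  unfolding cone_kernel_def[abs_def] by measurable

lemma cone_kernel_nonneg: "cone_kernel u z \<ge> 0"
  by (simp add: cone_kernel_def)

lemma cone_kernel_le:
  assumes "norm u = 1" shows "cone_kernel u z \<le> 1 / norm z"
proof (cases "z = 0")
  case False
  have "Im (z / u) \<le> norm z"
    using abs_Im_le_cmod[of "z / u"] assms by (simp add: norm_divide)
  then have "Im (z / u) / (norm z)\<^sup>2 \<le> norm z / (norm z)\<^sup>2" by (rule divide_right_mono) simp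
  then show ?thesis using False by (simp add: cone_kernel_def power2_eq_square)
qed (simp add: cone_kernel_def)

lemma cone_kernel_scaleR:
  assumes "r > 0" shows "cone_kernel u (r *\<^sub>R z) = cone_kernel u z / r"
proof -
  have eq: "(r *\<^sub>R z) / u = r *\<^sub>R (z / u)" by (simp add: scaleR_conv_of_real)
  show ?thesis unfolding cone_kernel_def eq
    using assms by (simp add: abs_mult power2_eq_square)
qed

lemma cone_kernel_integrable:
  fixes E :: "complex set"
  assumes u: "norm u = 1" and E [measurable]: "E \<in> sets borel" and fin: "emeasure lborel E < \<infinity>"
  shows "set_integrable lborel E (\<lambda>x. cone_kernel u (x - w))"
    and "(LINT x:E|lborel. cone_kernel u (x - w)) \<le> newton_const + measure lborel E"
proof -
  note i = inverse_norm_integral[OF E fin zero_less_one, of w]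
  show int: "set_integrable lborel E (\<lambda>x. cone_kernel u (x - w))"
    unfolding set_integrable_def
    by (rule Bochner_Integration.integrable_bound[OF i(1)[unfolded set_integrable_def]])
       (use cone_kernel_le[OF u] cone_kernel_nonneg in \<open>auto simp: indicator_def\<close>)
  have "(LINT x:E|lborel. cone_kernel u (x - w)) \<le> (LINT x:E|lborel. 1 / norm (x - w))"
    by (rule set_integral_mono[OF int i(1)]) (rule cone_kernel_le[OF u])
  with i(2) show "(LINT x:E|lborel. cone_kernel u (x - w)) \<le> newton_const + measure lborel E" by simp
qed

lemma ennreal_cone_integral:
  fixes E :: "complex set"
  assumes "norm u = 1" "E \<in> sets borel" "emeasure lborel E < \<infinity>"
  shows "ennreal (LINT x:E|lborel. cone_kernel u (x - w)) = (\<integral>\<^sup>+x\<in>E. ennreal (cone_kernel u (x - w)) \<partial>lborel)"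
proof -
  have "(\<integral>\<^sup>+x\<in>E. ennreal (cone_kernel u (x - w)) \<partial>lborel) = (\<integral>\<^sup>+x. ennreal (indicator E x *\<^sub>R cone_kernel u (x - w)) \<partial>lborel)"
    by (intro nn_integral_cong) (simp add: indicator_def)
  then show ?thesis
    using cone_kernel_integrable(1)[OF assms, of w] cone_kernel_nonneg
    unfolding set_lebesgue_integral_def set_integrable_def
    by (simp add: nn_integral_eq_integral)
qed

text \<open>In polar coordinates the value is \<open>sqrt 2\<close> for every \<open>u\<close> of
  modulus 1. Keeping \<open>u\<close> as an argument spares a change of variables by a rotation;
  only positivity will be used.\<close>

definition cone_const :: "complex \<Rightarrow> real" where
  "cone_const u = (LINT x:ball 0 1|lborel. cone_kernel u x)"

lemma emeasure_ball_complex_finite: "emeasure lborel (ball (w::complex) r) < \<infinity>"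
  by (rule emeasure_bounded_finite) simp

lemma cone_integral_ball:
  assumes u: "norm u = 1" and r: "r > 0"
  shows "(LINT x:ball w r|lborel. cone_kernel u (x - w)) = cone_const u * r"
proof -
  have c0: "cone_const u \<ge> 0"
    unfolding cone_const_def set_lebesgue_integral_def
    by (rule integral_nonneg_AE) (simp add: cone_kernel_nonneg)
  have fin: "(\<integral>\<^sup>+x\<in>ball 0 1. ennreal (cone_kernel u x) \<partial>lborel) = ennreal (cone_const u)"
    using ennreal_cone_integral[OF u _ emeasure_ball_complex_finite, of 0 1 0] by (simp add: cone_const_def)
  have "ennreal (LINT x:ball w r|lborel. cone_kernel u (x - w)) = (\<integral>\<^sup>+x\<in>ball w r. ennreal (cone_kernel u (x - w)) \<partial>lborel)"
    by (rule ennreal_cone_integral[OF u _ emeasure_ball_complex_finite]) simp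
  also have "\<dots> = ennreal (r\<^sup>2) * (\<integral>\<^sup>+x\<in>ball 0 1. ennreal (cone_kernel u (r *\<^sub>R x)) \<partial>lborel)"
    by (rule nn_integral_ball_affine[OF _ r]) measurable
  also have "(\<integral>\<^sup>+x\<in>ball 0 1. ennreal (cone_kernel u (r *\<^sub>R x)) \<partial>lborel)
     = (\<integral>\<^sup>+x. ennreal (1 / r) * (ennreal (cone_kernel u x) * indicator (ball 0 1) x) \<partial>lborel)"
    using r cone_kernel_nonneg
    by (intro nn_integral_cong) (simp add: cone_kernel_scaleR mult.assoc[symmetric] ennreal_mult[symmetric])
  also have "\<dots> = ennreal (1 / r) * ennreal (cone_const u)"
    unfolding fin[symmetric] by (rule nn_integral_cmult) measurable
  also have "ennreal (r\<^sup>2) * (ennreal (1 / r) * ennreal (cone_const u)) = ennreal (cone_const u * r)"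
    using r c0 by (simp add: ennreal_mult[symmetric] power2_eq_square)
  finally have "ennreal (LINT x:ball w r|lborel. cone_kernel u (x - w)) = ennreal (cone_const u * r)" .
  moreover have "(LINT x:ball w r|lborel. cone_kernel u (x - w)) \<ge> 0"
    unfolding set_lebesgue_integral_def
    by (rule integral_nonneg_AE) (simp add: cone_kernel_nonneg)
  ultimately show ?thesis using c0 r by simp
qed

lemma cone_const_pos:
  assumes u: "norm u = 1" shows "cone_const u > 0"
proof -
  \<comment> \<open>A point on the axis of the cone. The disc of radius 1/8 about it stays in the
    cone and in the unit disc: relative to \<open>u\<close>, real parts are at most 1/8 in modulus
    and imaginary parts at least 3/8.\<close>
  let ?b = "u * (\<i> / 2)"
  have u0: "u \<noteq> 0" using u by auto
  have kb: "3/8 \<le> cone_kernel u x" and x1: "x \<in> ball 0 1" if x: "x \<in> ball ?b (1/8)" for x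
  proof -
    define t where "t = x / u - \<i> / 2"
    have xt: "x / u = \<i> / 2 + t" by (simp add: t_def)
    have "norm t = norm ((x - ?b) / u)" using u0 by (simp add: t_def field_simps)
    also have "\<dots> = dist ?b x" using u by (simp add: norm_divide dist_norm norm_minus_commute)
    finally have t: "norm t < 1/8" using x by simp
    have re: "\<bar>Re t\<bar> < 1/8" and im: "\<bar>Im t\<bar> < 1/8"
      using abs_Re_le_cmod[of t] abs_Im_le_cmod[of t] t by auto
    have "norm x = norm (x / u)" using u by (simp add: norm_divide)
    also have "\<dots> \<le> norm (\<i> / 2) + norm t" unfolding xt by (rule norm_triangle_ineq)
    also have "\<dots> < 1" using t by (simp add: norm_divide)
    finally have nx: "norm x < 1" .
    then show "x \<in> ball 0 1" by simp
    have Im: "3/8 \<le> Im (x / u)" and Re: "\<bar>Re (x / u)\<bar> \<le> 1/8" unfolding xt using re im by auto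
    have "x \<noteq> 0" using Im by auto
    then have "0 < (norm x)\<^sup>2" "(norm x)\<^sup>2 \<le> 1" using nx by (auto simp: abs_square_le_1)
    then have "3/8 \<le> Im (x / u) / (norm x)\<^sup>2"
      using Im by (simp add: pos_le_divide_eq)
    then show "3/8 \<le> cone_kernel u x" using Im Re by (simp add: cone_kernel_def)
  qed
  have int: "set_integrable lborel (ball 0 1) (\<lambda>x. cone_kernel u x)"
    using cone_kernel_integrable(1)[OF u _ emeasure_ball_complex_finite, of 0 1 0] by simp
  have "0 < 3/8 * measure lborel (ball ?b (1/8))" by (simp add: content_ball_pos)
  also have "\<dots> = (\<integral>x. 3/8 * indicator (ball ?b (1/8)) x \<partial>lborel)" by simp
  also have "\<dots> \<le> (\<integral>x. indicator (ball 0 1) x *\<^sub>R cone_kernel u x \<partial>lborel)"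
  proof (rule integral_mono)
    show "integrable lborel (\<lambda>x. 3/8 * indicator (ball ?b (1/8)) x :: real)"
      using emeasure_ball_complex_finite by (intro integrable_mult_right integrable_real_indicator) auto
    show "integrable lborel (\<lambda>x. indicator (ball 0 1) x *\<^sub>R cone_kernel u x)"
      using int by (simp add: set_integrable_def)
    show "3/8 * indicator (ball ?b (1/8)) x \<le> indicator (ball 0 1) x *\<^sub>R cone_kernel u x" for x
      using kb[of x] x1[of x] cone_kernel_nonneg[of u x] by (auto simp: indicator_def)
  qed
  finally show ?thesis by (simp add: cone_const_def set_lebesgue_integral_def)
qed

definition cone_potential :: "complex \<Rightarrow> complex set \<Rightarrow> complex \<Rightarrow> real" where
  "cone_potential u D w = (LINT x:D|lborel. cone_kernel u (x - w))"

lemma cone_potential_pos: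
  assumes u: "norm u = 1" and D: "open D" and fin: "emeasure lborel D < \<infinity>" and w: "w \<in> D"
  shows "cone_potential u D w > 0"
proof -
  obtain e where e: "e > 0" "ball w e \<subseteq> D" using D w open_contains_ball by metis
  have "0 < cone_const u * e" using cone_const_pos[OF u] e by simp
  also have "\<dots> = (LINT x:ball w e|lborel. cone_kernel u (x - w))" by (rule cone_integral_ball[OF u e(1), symmetric])
  also have "\<dots> \<le> cone_potential u D w"
    unfolding cone_potential_def set_lebesgue_integral_def
  proof (rule integral_mono)
    show "integrable lborel (\<lambda>x. indicator (ball w e) x *\<^sub>R cone_kernel u (x - w))"
      using cone_kernel_integrable(1)[OF u _ emeasure_ball_complex_finite, of w e w] by (simp add: set_integrable_def)
    show "integrable lborel (\<lambda>x. indicator D x *\<^sub>R cone_kernel u (x - w))"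
      using cone_kernel_integrable(1)[OF u _ fin, of w] D by (simp add: set_integrable_def)
    show "indicator (ball w e) x *\<^sub>R cone_kernel u (x - w) \<le> indicator D x *\<^sub>R cone_kernel u (x - w)" for x
      using e(2) cone_kernel_nonneg[of u "x - w"] by (auto simp: indicator_def)
  qed
  finally show ?thesis .
qed

lemma Im_mult_inverse_eq_cone_kernel:
  assumes u: "norm u = 1" and c: "\<bar>Re ((x - w) / u)\<bar> \<le> Im ((x - w) / u)"
  shows "Im (u * (1 / (w - x))) = cone_kernel u (x - w)"
proof -
  define \<eta> where "\<eta> = (x - w) / u"
  have "u \<noteq> 0" using u by auto
  have "u * (1 / (w - x)) = - inverse \<eta>"
    using minus_divide_right[of u "x - w"] by (simp add: \<eta>_def)
  moreover have "Im (- inverse \<eta>) = Im \<eta> / (norm \<eta>)\<^sup>2" by (simp add: cmod_power2)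
  moreover have "norm \<eta> = norm (x - w)" using u by (simp add: \<eta>_def norm_divide)
  ultimately show ?thesis using c
    unfolding cone_kernel_def \<eta>_def[symmetric] by (simp only: if_True)
qed

text \<open>
  The radius \<open>r\<close> is chosen such that the part \<open>E\<close> of the cone of radius \<open>r\<close> at \<open>w = f z\<close> lying outside \<open>D\<close>
  carries at least half of the kernel integral. The function \<open>y \<mapsto> (y - w) * cauchy_transform E y\<close> is then
  bounded on \<open>D\<close> by a multiple of \<open>r\<^sup>2\<close>, while its derivative at \<open>w\<close> is at least of order \<open>r\<close>.
\<close>

lemma deriv_le_cone_potential:
  assumes u: "norm u = 1" and D: "open D" and fin: "emeasure lborel D < \<infinity>"
    and holf: "f holomorphic_on ball z R" and R: "R > 0" and fD: "f ` ball z R \<subseteq> D"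
  shows "norm (deriv f z) * R \<le> 8 * (newton_const + pi) / (cone_const u)\<^sup>2 * cone_potential u D (f z)"
proof -
  define w where "w = f z"
  define J where "J = cone_potential u D w"
  define c where "c = cone_const u"
  \<comment> \<open>The whole cone of radius \<open>r\<close> has kernel integral
    \<open>c * r = 2 * J\<close>. The part in \<open>D\<close> accounts for at most
    \<open>J\<close>, so at least \<open>J\<close> is left for \<open>E\<close>.\<close>
  define r where "r = 2 * J / c"
  define E where "E = ball w r \<inter> {x. \<bar>Re ((x - w) / u)\<bar> \<le> Im ((x - w) / u)} - D"
  define N where "N = newton_const + pi"
  have wD: "w \<in> D" using fD R by (auto simp: w_def)
  have J: "J > 0" unfolding J_def by (rule cone_potential_pos[OF u D fin wD])
  have c: "c > 0" unfolding c_def by (rule cone_const_pos[OF u])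
  have r: "r > 0" using J c by (simp add: r_def)
  have [measurable]: "D \<in> sets borel" using D by simp
  have E [measurable]: "E \<in> sets borel" unfolding E_def by measurable
  have Esub: "E \<subseteq> ball w r" by (auto simp: E_def)
  have finE: "emeasure lborel E < \<infinity>"
    by (rule le_less_trans[OF emeasure_mono[OF Esub] emeasure_ball_complex_finite]) simp
  have mE: "measure lborel E \<le> pi * r\<^sup>2"
  proof -
    have "measure lborel E \<le> measure lborel (ball w r)"
      using Esub emeasure_ball_complex_finite[of w r] by (intro measure_mono_fmeasurable) (auto simp: fmeasurable_def)
    also have "\<dots> = pi * r\<^sup>2" using r by (simp add: content_ball unit_ball_vol_2)
    finally show ?thesis .
  qed
  define g where "g = cauchy_transform E"
  have g_le: "norm (g y) \<le> N * r" for y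
  proof -
    have "norm (g y) \<le> newton_const * r + measure lborel E / r"
      unfolding g_def by (rule cauchy_transform_integrable(2)[OF E finE r])
    also have "measure lborel E / r \<le> pi * r\<^sup>2 / r" using mE r by (intro divide_right_mono) auto
    also have "newton_const * r + pi * r\<^sup>2 / r = N * r" using r by (simp add: N_def power2_eq_square algebra_simps)
    finally show ?thesis by simp
  qed
  \<comment> \<open>The factor \<open>y - w\<close> turns a large value at \<open>w\<close> into a
    large derivative there: the product vanishes at \<open>w\<close> with derivative
    \<open>g w\<close>. It costs little, since \<open>g\<close> is of order \<open>r\<close>
    everywhere and beyond distance \<open>2 * r\<close> decays like the reciprocal distance.\<close>
  have h_le: "norm ((y - w) * g y) \<le> 2 * N * r\<^sup>2" for y
  proof (cases "norm (y - w) \<le> 2 * r")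
    case True
    then have "norm (y - w) * norm (g y) \<le> (2 * r) * (N * r)"
      using g_le[of y] r by (intro mult_mono) auto
    then show ?thesis by (simp add: norm_mult power2_eq_square mult_ac)
  next
    case False
    then have y: "norm (y - w) > 2 * r" by simp
    have "norm (g y) \<le> 2 / norm (y - w) * measure lborel E"
      unfolding g_def cauchy_transform_def
    proof (rule set_integrable_bounded(2)[OF E _ finE])
      fix x assume "x \<in> E"
      then have "norm (x - w) < r" using Esub by (auto simp: dist_norm norm_minus_commute)
      moreover have "norm (y - w) \<le> norm (y - x) + norm (x - w)"
        using norm_triangle_ineq[of "y - x" "x - w"] by simp
      ultimately have "norm (y - w) / 2 \<le> norm (y - x)" using y by linarith
      then have "1 / norm (y - x) \<le> 1 / (norm (y - w) / 2)" using y r by (intro frac_le) auto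
      then show "norm (1 / (y - x)) \<le> 2 / norm (y - w)" by (simp add: norm_divide)
    qed auto
    also have "\<dots> \<le> 2 / norm (y - w) * (pi * r\<^sup>2)" using mE by (intro mult_left_mono) auto
    finally have "norm (y - w) * norm (g y) \<le> norm (y - w) * (2 / norm (y - w) * (pi * r\<^sup>2))"
      by (rule mult_left_mono) simp
    also have "\<dots> = 2 * pi * r\<^sup>2" using y r by auto
    also have "\<dots> \<le> 2 * N * r\<^sup>2" using newton_const_nonneg by (simp add: N_def mult_right_mono)
    finally show ?thesis by (simp add: norm_mult)
  qed
  have holg: "g holomorphic_on D" unfolding g_def
    by (rule cauchy_transform_holomorphic[OF E finE D]) (auto simp: E_def)
  define h where "h y = (f y - w) * g (f y)" for y
  have "g \<circ> f holomorphic_on ball z R"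
    by (rule holomorphic_on_compose_gen[OF holf holg]) (use fD in auto)
  then have holh: "h holomorphic_on ball z R"
    unfolding h_def o_def by (intro holomorphic_intros holf)
  have bd: "norm (deriv h z) * R \<le> 2 * N * r\<^sup>2"
    by (rule norm_deriv_le_of_bounded[OF holh R]) (unfold h_def, rule h_le)
  have dh: "deriv h z = deriv f z * g w"
  proof -
    have zb: "z \<in> ball z R" using R by simp
    have df: "(f has_field_derivative deriv f z) (at z)"
      by (rule holomorphic_derivI[OF holf open_ball zb])
    have dg: "(g has_field_derivative deriv g w) (at (f z))"
      unfolding w_def by (rule holomorphic_derivI[OF holg D]) (use wD w_def in simp)
    have "((\<lambda>y. (f y - w) * g (f y)) has_field_derivative
        (deriv f z - 0) * g (f z) + (deriv g w * deriv f z) * (f z - w)) (at z)"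
      by (intro DERIV_mult DERIV_diff df DERIV_const DERIV_chain2[OF dg df])
    then show ?thesis unfolding h_def[abs_def, symmetric] by (intro DERIV_imp_deriv) (simp add: w_def[symmetric])
  qed
  have gw: "J \<le> norm (g w)"
  proof -
    note iE = cauchy_transform_integrable(1)[OF E finE r, of w]
    have iuE: "set_integrable lborel E (\<lambda>x. u * (1 / (w - x)))" using iE by (rule set_integrable_mult_right)
    have "u * g w = (LINT x:E|lborel. u * (1 / (w - x)))"
      unfolding g_def cauchy_transform_def by (rule set_integral_mult_right[symmetric])
    then have "Im (u * g w) = (\<integral>x. Im (indicator E x *\<^sub>R (u * (1 / (w - x)))) \<partial>lborel)"
      using iuE unfolding set_lebesgue_integral_def set_integrable_def by (simp only: integral_Im)
    also have "\<dots> = (\<integral>x. indicator E x *\<^sub>R cone_kernel u (x - w) \<partial>lborel)"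
    proof (rule Bochner_Integration.integral_cong[OF refl])
      fix x
      have "Im (u * (1 / (w - x))) = cone_kernel u (x - w)" if "x \<in> E"
        by (rule Im_mult_inverse_eq_cone_kernel[OF u]) (use that in \<open>simp add: E_def\<close>)
      then show "Im (indicator E x *\<^sub>R (u * (1 / (w - x)))) = indicator E x *\<^sub>R cone_kernel u (x - w)"
        by (cases "x \<in> E") simp_all
    qed
    finally have ImE: "Im (u * g w) = (\<integral>x. indicator E x *\<^sub>R cone_kernel u (x - w) \<partial>lborel)" .
    have iD: "integrable lborel (\<lambda>x. indicator D x *\<^sub>R cone_kernel u (x - w))"
      using cone_kernel_integrable(1)[OF u _ fin, of w] by (simp add: set_integrable_def)
    have iE': "integrable lborel (\<lambda>x. indicator E x *\<^sub>R cone_kernel u (x - w))"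
      using cone_kernel_integrable(1)[OF u E finE, of w] by (simp add: set_integrable_def)
    have "2 * J = c * r" using c by (simp add: r_def)
    also have "\<dots> = (\<integral>x. indicator (ball w r) x *\<^sub>R cone_kernel u (x - w) \<partial>lborel)"
      using cone_integral_ball[OF u r, of w] by (simp add: set_lebesgue_integral_def c_def)
    also have "\<dots> \<le> (\<integral>x. indicator E x *\<^sub>R cone_kernel u (x - w) + indicator D x *\<^sub>R cone_kernel u (x - w) \<partial>lborel)"
    proof (rule integral_mono[OF _ Bochner_Integration.integrable_add[OF iE' iD]])
      show "integrable lborel (\<lambda>x. indicator (ball w r) x *\<^sub>R cone_kernel u (x - w))"
        using cone_kernel_integrable(1)[OF u _ emeasure_ball_complex_finite, of w r w] by (simp add: set_integrable_def)
      fix x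
      have "cone_kernel u (x - w) = 0" if "x \<in> ball w r" "x \<notin> E" "x \<notin> D"
        using that by (auto simp: E_def cone_kernel_def)
      then show "indicator (ball w r) x *\<^sub>R cone_kernel u (x - w) \<le>
          indicator E x *\<^sub>R cone_kernel u (x - w) + indicator D x *\<^sub>R cone_kernel u (x - w)"
        using cone_kernel_nonneg[of u "x - w"] by (auto simp: indicator_def)
    qed
    also have "\<dots> = Im (u * g w) + J"
      unfolding ImE J_def cone_potential_def set_lebesgue_integral_def
      by (rule Bochner_Integration.integral_add[OF iE' iD])
    finally have "J \<le> Im (u * g w)" by simp
    also have "\<dots> \<le> norm (u * g w)" using abs_Im_le_cmod[of "u * g w"] by linarith
    finally show ?thesis using u by (simp add: norm_mult)
  qed
  \<comment> \<open>As \<open>r\<close> is proportional to \<open>J\<close>, the upper bound is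
    quadratic in \<open>J\<close> and the lower bound linear. Cancelling one \<open>J\<close> leaves
    the linear estimate, with \<open>2 * N * (2 / c) ^ 2 = 8 * N / c ^ 2\<close>.\<close>
  have "norm (deriv f z) * R * J \<le> norm (deriv f z) * R * norm (g w)"
    using gw R by (intro mult_left_mono) auto
  also have "\<dots> \<le> 2 * N * r\<^sup>2" using bd by (simp add: dh norm_mult mult_ac)
  finally have "norm (deriv f z) * R * J \<le> (8 * N / c\<^sup>2 * J) * J"
    by (simp add: r_def power2_eq_square mult_ac)
  then have "norm (deriv f z) * R \<le> 8 * N / c\<^sup>2 * J" using J by (rule mult_right_le_imp_le)
  then show ?thesis by (simp add: N_def c_def J_def w_def)
qed

section \<open>Lengths along a ray in a domain of finite area\<close>

text \<open>In the coordinates \<open>z / u = x + i y\<close>, the cone with vertex parameter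
  \<open>s\<close> contains \<open>z\<close> only if \<open>\<bar>x - s\<bar> \<le> y\<close>. This
  is an interval of length \<open>2 * y\<close> on which the kernel is at most \<open>1 / y\<close>,
  whence the 2. Moreover \<open>s \<ge> T\<close> then forces \<open>x + y \<ge> T\<close>.\<close>

lemma cone_kernel_line_integral:
  assumes u: "norm u = 1"
  shows "(\<integral>\<^sup>+s\<in>{T..}. ennreal (cone_kernel u (z - of_real s * u)) \<partial>lborel)
    \<le> 2 * indicator {z. T \<le> Re (z / u) + Im (z / u)} z"
proof -
  have u0: "u \<noteq> 0" using u by auto
  define x y where "x = Re (z / u)" and "y = Im (z / u)"
  have shift: "(z - of_real s * u) / u = z / u - of_real s" for s using u0 by (simp add: diff_divide_distrib)
  have nz: "norm (z - of_real s * u) = norm (z / u - of_real s)" for s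
    using u unfolding shift[symmetric] by (simp add: norm_divide)
  have le: "ennreal (cone_kernel u (z - of_real s * u)) * indicator {T..} s
      \<le> ennreal (1 / y) * indicator {x - y..x + y} s * indicator {z. T \<le> Re (z / u) + Im (z / u)} z" for s
  proof (cases "\<bar>x - s\<bar> \<le> y \<and> y > 0 \<and> T \<le> s")
    case True
    have "y\<^sup>2 \<le> (norm (z - of_real s * u))\<^sup>2" unfolding nz cmod_power2 by (simp add: y_def)
    then have "y / (norm (z - of_real s * u))\<^sup>2 \<le> y / y\<^sup>2" using True by (intro frac_le) auto
    also have "\<dots> = 1 / y" by (simp add: power2_eq_square)
    finally have "cone_kernel u (z - of_real s * u) \<le> 1 / y"
      using True by (simp add: cone_kernel_def shift x_def y_def)
    then show ?thesis using True by (auto simp: indicator_def x_def y_def intro!: ennreal_leI)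
  next
    case False
    \<comment> \<open>This includes \<open>y = 0\<close>, where the numerator of the kernel
      vanishes.\<close>
    then have "cone_kernel u (z - of_real s * u) = 0 \<or> s \<notin> {T..}"
      unfolding cone_kernel_def shift x_def y_def by auto
    then show ?thesis by (auto simp: indicator_def)
  qed
  have "(\<integral>\<^sup>+s\<in>{T..}. ennreal (cone_kernel u (z - of_real s * u)) \<partial>lborel)
    \<le> (\<integral>\<^sup>+s. ennreal (1 / y) * indicator {x - y..x + y} s * indicator {z. T \<le> Re (z / u) + Im (z / u)} z \<partial>lborel)"
    by (rule nn_integral_mono) (rule le)
  also have "\<dots> = ennreal (1 / y) * emeasure lborel {x - y..x + y} * indicator {z. T \<le> Re (z / u) + Im (z / u)} z"
    by (simp add: nn_integral_multc nn_integral_cmult_indicator)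
  also have "\<dots> \<le> 2 * indicator {z. T \<le> Re (z / u) + Im (z / u)} z"
  proof (rule mult_right_mono)
    show "ennreal (1 / y) * emeasure lborel {x - y..x + y} \<le> 2"
    proof (cases "y > 0")
      case True
      then have "ennreal (1 / y) * emeasure lborel {x - y..x + y} = ennreal (1 / y * (2 * y))"
        by (subst ennreal_mult) auto
      also have "\<dots> = 2" using True by simp
      finally show ?thesis by simp
    qed (simp add: ennreal_neg)
  qed simp
  finally show ?thesis .
qed

lemma cone_potential_ray_integral:
  assumes u: "norm u = 1" and D: "open D" and fin: "emeasure lborel D < \<infinity>"
  shows "(\<integral>\<^sup>+s\<in>{T..}. ennreal (cone_potential u D (a + of_real s * u)) \<partial>lborel)
    \<le> 2 * emeasure lborel (D \<inter> {z. T \<le> Re ((z - a) / u) + Im ((z - a) / u)})"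
proof -
  have [measurable]: "D \<in> sets borel" using D by simp
  define F where "F x s = ennreal (cone_kernel u (x - (a + of_real s * u))) * indicator D x * indicator {T..} s"
    for x s
  have F: "case_prod F \<in> borel_measurable (lborel \<Otimes>\<^sub>M lborel)"
    unfolding F_def[abs_def] by measurable
  have "(\<integral>\<^sup>+s\<in>{T..}. ennreal (cone_potential u D (a + of_real s * u)) \<partial>lborel) = (\<integral>\<^sup>+s. (\<integral>\<^sup>+x. F x s \<partial>lborel) \<partial>lborel)"
  proof (rule nn_integral_cong)
    fix s
    have "ennreal (cone_potential u D (a + of_real s * u)) = (\<integral>\<^sup>+x\<in>D. ennreal (cone_kernel u (x - (a + of_real s * u))) \<partial>lborel)"
      unfolding cone_potential_def by (rule ennreal_cone_integral[OF u _ fin]) measurable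
    then show "ennreal (cone_potential u D (a + of_real s * u)) * indicator {T..} s = (\<integral>\<^sup>+x. F x s \<partial>lborel)"
      unfolding F_def by (simp add: nn_integral_multc)
  qed
  also have "\<dots> = (\<integral>\<^sup>+x. (\<integral>\<^sup>+s. F x s \<partial>lborel) \<partial>lborel)"
    by (rule lborel_pair.Fubini'[OF F])
  also have "\<dots> \<le> (\<integral>\<^sup>+x. 2 * indicator (D \<inter> {z. T \<le> Re ((z - a) / u) + Im ((z - a) / u)}) x \<partial>lborel)"
  proof (rule nn_integral_mono)
    fix x
    have "(\<integral>\<^sup>+s. F x s \<partial>lborel) = indicator D x * (\<integral>\<^sup>+s\<in>{T..}. ennreal (cone_kernel u ((x - a) - of_real s * u)) \<partial>lborel)"
      unfolding F_def by (subst nn_integral_cmult[symmetric]) (auto intro!: nn_integral_cong simp: algebra_simps)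
    also have "\<dots> \<le> indicator D x * (2 * indicator {z. T \<le> Re (z / u) + Im (z / u)} (x - a))"
      by (rule mult_left_mono[OF cone_kernel_line_integral[OF u]]) simp
    also have "\<dots> = 2 * indicator (D \<inter> {z. T \<le> Re ((z - a) / u) + Im ((z - a) / u)}) x"
      by (simp add: indicator_def)
    finally show "(\<integral>\<^sup>+s. F x s \<partial>lborel) \<le> \<dots>" .
  qed
  also have "\<dots> = 2 * emeasure lborel (D \<inter> {z. T \<le> Re ((z - a) / u) + Im ((z - a) / u)})"
    by (rule nn_integral_cmult_indicator) measurable
  finally show ?thesis .
qed

text \<open>Here finite area gives smallness and not merely boundedness: the half-planes decrease to
  the empty set, so continuity from above applies. This is the source of the o.\<close>

lemma emeasure_halfplane_tail:
  assumes D: "open D" and fin: "emeasure lborel D < \<infinity>" and \<epsilon>: "\<epsilon> > 0"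
  obtains T :: real where "T > 0" "emeasure lborel (D \<inter> {z. T \<le> Re ((z - a) / u) + Im ((z - a) / u)}) < ennreal \<epsilon>"
proof -
  have [measurable]: "D \<in> sets borel" using D by simp
  define A where "A n = D \<inter> {z. real n \<le> Re ((z - a) / u) + Im ((z - a) / u)}" for n
  have "(\<lambda>n. emeasure lborel (A n)) \<longlonglongrightarrow> emeasure lborel (\<Inter>n. A n)"
  proof (rule Lim_emeasure_decseq)
    show "range A \<subseteq> sets lborel" unfolding A_def by auto
    show "decseq A" unfolding A_def decseq_def by auto
    show "emeasure lborel (A n) \<noteq> \<infinity>" for n
    proof -
      have "emeasure lborel (A n) \<le> emeasure lborel D" by (rule emeasure_mono) (auto simp: A_def)
      then show ?thesis using fin by auto
    qed
  qed
  moreover have "(\<Inter>n. A n) = {}"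
  proof (rule equals0I)
    fix z assume z: "z \<in> (\<Inter>n. A n)"
    obtain n :: nat where "Re ((z - a) / u) + Im ((z - a) / u) < real n" using reals_Archimedean2 by blast
    moreover have "z \<in> A n" using z by blast
    ultimately show False by (simp add: A_def)
  qed
  ultimately have "(\<lambda>n. emeasure lborel (A n)) \<longlonglongrightarrow> 0" by simp
  then have "\<forall>\<^sub>F n in sequentially. emeasure lborel (A n) < ennreal \<epsilon>"
    by (rule order_tendstoD) (use \<epsilon> in simp)
  then have "\<forall>\<^sub>F n in sequentially. emeasure lborel (A n) < ennreal \<epsilon> \<and> n > 0"
    using eventually_gt_at_top[of 0] by eventually_elim simp
  then obtain n where "emeasure lborel (A n) < ennreal \<epsilon>" "n > 0"
    unfolding eventually_sequentially by blast
  then show ?thesis using that[of "real n"] by (simp add: A_def)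
qed

section \<open>The Cauchy-Schwarz step and lengths of segments\<close>

text \<open>Cauchy-Schwarz for \<open>sqrt f\<close> and its reciprocal, obtained by integrating
  \<open>2 \<le> q + 1 / q\<close> with \<open>q = c * f x\<close>.\<close>

lemma length_le_sqrt_integrals:
  fixes f :: "real \<Rightarrow> real"
  assumes f: "continuous_on {a..b} f" and pos: "\<And>x. x \<in> {a..b} \<Longrightarrow> f x > 0" and ab: "a \<le> b"
  shows "(b - a)\<^sup>2 \<le> integral {a..b} f * integral {a..b} (\<lambda>x. 1 / f x)"
proof (cases "a = b")
  case False
  then have ab: "a < b" using ab by simp
  have g: "continuous_on {a..b} (\<lambda>x. 1 / f x)"
    by (intro continuous_intros f ballI) (drule pos, simp)
  define X Y where "X = integral {a..b} f" and "Y = integral {a..b} (\<lambda>x. 1 / f x)"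
  have iX: "f integrable_on {a..b}" and iY: "(\<lambda>x. 1 / f x) integrable_on {a..b}"
    using f g integrable_continuous_real by blast+
  have "\<exists>x\<in>{a..b}. \<forall>y\<in>{a..b}. f x \<le> f y"
    by (rule continuous_attains_inf[OF _ _ f]) (use ab in auto)
  then obtain m where m: "m > 0" "\<And>y. y \<in> {a..b} \<Longrightarrow> m \<le> f y" using pos by blast
  have "0 < m * (b - a)" using m(1) ab by simp
  also have "\<dots> = integral {a..b} (\<lambda>x. m)" using ab by simp
  also have "\<dots> \<le> X" unfolding X_def using m iX by (intro integral_le) auto
  finally have X: "X > 0" .
  \<comment> \<open>With this scaling \<open>c * f\<close> integrates to \<open>b - a\<close>, which
    cancels half of the left-hand side \<open>2 * (b - a)\<close>.\<close>
  define c where "c = (b - a) / X"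
  have c: "c > 0" using X ab by (simp add: c_def)
  have "2 * (b - a) = integral {a..b} (\<lambda>x. 2)" using ab by simp
  also have "\<dots> \<le> integral {a..b} (\<lambda>x. c * f x + 1 / c * (1 / f x))"
  proof (rule integral_le)
    show "(\<lambda>x. c * f x + 1 / c * (1 / f x)) integrable_on {a..b}"
      by (intro integrable_add integrable_on_mult_right iX iY)
    fix x assume x: "x \<in> {a..b}"
    define q where "q = c * f x"
    have q: "q > 0" using c pos[OF x] by (simp add: q_def)
    have "0 \<le> (q - 1)\<^sup>2 / q" using q by simp
    also have "\<dots> = q + 1 / q - 2" using q by (simp add: field_simps power2_eq_square)
    finally show "2 \<le> c * f x + 1 / c * (1 / f x)" by (simp add: q_def)
  qed (rule integrable_const_ivl)
  also have "\<dots> = integral {a..b} (\<lambda>x. c * f x) + integral {a..b} (\<lambda>x. 1 / c * (1 / f x))"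
    by (rule integral_add[OF integrable_on_mult_right[OF iX] integrable_on_mult_right[OF iY]])
  also have "\<dots> = c * X + 1 / c * Y"
    by (simp only: integral_mult_right X_def Y_def)
  also have "c * X = b - a" using X by (simp add: c_def)
  finally have "b - a \<le> 1 / c * Y" by simp
  then have "(b - a) * c \<le> Y" using c by (simp add: field_simps)
  then have "(b - a)\<^sup>2 \<le> X * Y" using X by (simp add: c_def power2_eq_square field_simps)
  then show ?thesis by (simp add: X_def Y_def)
qed simp

lemma euclidean_length_linepath: "euclidean_length (linepath a b) = norm (b - a)"
proof -
  have "euclidean_length (linepath a b) = integral {0..1} (\<lambda>s::real. norm (b - a))"
    unfolding euclidean_length_def
    by (rule integral_cong) (simp add: vector_derivative_linepath_within)
  then show ?thesis by simp
qed

lemma hyperbolic_length_ray_segment: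
  assumes "norm u = 1" and "t > 0"
    and int: "(\<lambda>s. hyperbolic_density D (a + of_real s * u)) integrable_on {0..t}"
  shows "hyperbolic_length D (linepath a (a + of_real t * u))
     = integral {0..t} (\<lambda>s. hyperbolic_density D (a + of_real s * u))"
proof -
  define f where "f s = hyperbolic_density D (a + of_real s * u)" for s
  have "(f has_integral integral {0..t} f) (cbox 0 t)"
    using int by (simp add: f_def[abs_def] integrable_integral)
  from has_integral_affinity'[OF this \<open>t > 0\<close>, of 0]
  have "((\<lambda>x. f (t * x)) has_integral integral {0..t} f / t) {0..1}"
    using \<open>t > 0\<close> by (simp add: field_simps)
  then have "((\<lambda>x. f (t * x) * t) has_integral integral {0..t} f / t * t) {0..1}"
    by (rule has_integral_mult_left)
  then have "integral {0..1} (\<lambda>x. f (t * x) * t) = integral {0..t} f / t * t"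
    by (rule integral_unique)
  moreover have "hyperbolic_length D (linepath a (a + of_real t * u)) = integral {0..1} (\<lambda>x. f (t * x) * t)"
    unfolding hyperbolic_length_def
  proof (rule integral_cong)
    fix s :: real assume s: "s \<in> {0..1}"
    have "linepath a (a + of_real t * u) s = a + of_real (t * s) * u"
      by (simp add: linepath_def scaleR_conv_of_real algebra_simps)
    then show "hyperbolic_density D (linepath a (a + of_real t * u) s) *
        norm (vector_derivative (linepath a (a + of_real t * u)) (at s within {0..1})) = f (t * s) * t"
      using s assms(1,2) by (simp add: vector_derivative_linepath_within f_def norm_mult)
  qed
  ultimately have "hyperbolic_length D (linepath a (a + of_real t * u)) = integral {0..t} f"
    using \<open>t > 0\<close> by (simp only: nonzero_divide_eq_eq less_imp_neq[symmetric] nonzero_eq_divide_eq) simp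
  then show ?thesis by (simp only: f_def[abs_def])
qed

section \<open>Covering, density and length in a domain of finite area\<close>

text \<open>The cone potential is at most \<open>newton_const\<close> plus the area of
  \<open>D\<close>, uniformly in the vertex, so the derivative estimate yields normality. The
  direction 1 is an arbitrary choice.\<close>

lemma finite_area_covering_exists:
  assumes "open D" "emeasure lborel D < \<infinity>" "w \<in> D"
  obtains p where "branch_map p (ball 0 1) D" "p 0 = w"
proof (rule disc_covering_exists[OF assms(1,3)])
  define K where "K = 8 * (newton_const + pi) / (cone_const 1)\<^sup>2"
  have K: "K \<ge> 0" using newton_const_nonneg by (simp add: K_def)
  fix f z R assume f: "R > 0" "f holomorphic_on ball z R" "f ` ball z R \<subseteq> D"
  have "norm (deriv f z) * R \<le> K * cone_potential 1 D (f z)"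
    unfolding K_def by (rule deriv_le_cone_potential[OF _ assms(1,2) f(2,1,3)]) simp
  also have "\<dots> \<le> K * (newton_const + measure lborel D)"
    unfolding cone_potential_def
    by (intro mult_left_mono K cone_kernel_integrable(2) assms(2)) (use assms(1) in auto)
  finally show "norm (deriv f z) * R \<le> K * (newton_const + measure lborel D)" .
qed (rule that)

text \<open>For a covering \<open>p\<close> centred over \<open>w\<close>,
  \<open>1 / \<lambda> w\<close> is half of \<open>norm (deriv p 0)\<close>. The derivative estimate
  for \<open>p\<close> on the unit disc therefore applies with constant 4 in place of 8.\<close>

lemma hyperbolic_density_finite_area:
  assumes D: "open D" "connected D" and fin: "emeasure lborel D < \<infinity>" and w: "w \<in> D"
  shows hyperbolic_density_pos: "hyperbolic_density D w > 0"
    and isCont_hyperbolic_density_finite_area: "isCont (hyperbolic_density D) w"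
    and inverse_hyperbolic_density_le: "norm u = 1 \<Longrightarrow>
      1 / hyperbolic_density D w \<le> 4 * (newton_const + pi) / (cone_const u)\<^sup>2 * cone_potential u D w"
proof -
  obtain p where p: "branch_map p (ball 0 1) D" "p 0 = w"
    by (rule finite_area_covering_exists[OF D(1) fin w])
  note d = hyperbolic_density_at_base[OF D p(1), unfolded p(2)]
  show "hyperbolic_density D w > 0" using d by simp
  show "isCont (hyperbolic_density D) w" using isCont_hyperbolic_density[OF D p(1)] p(2) by simp
  assume u: "norm u = 1"
  have "norm (deriv p 0) * 1 \<le> 8 * (newton_const + pi) / (cone_const u)\<^sup>2 * cone_potential u D w"
    using deriv_le_cone_potential[OF u D(1) fin branch_mapD(3)[OF p(1)] zero_less_one branch_mapD(4)[OF p(1)]]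
    unfolding p(2) .
  then have "norm (deriv p 0) / 2 \<le> 8 * (newton_const + pi) / (cone_const u)\<^sup>2 * cone_potential u D w / 2"
    by simp
  also have "\<dots> = 4 * (newton_const + pi) / (cone_const u)\<^sup>2 * cone_potential u D w"
  proof -
    have "8 * x / y * z / 2 = 4 * x / y * z" for x y z :: real by simp
    then show ?thesis .
  qed
  finally show "1 / hyperbolic_density D w \<le> 4 * (newton_const + pi) / (cone_const u)\<^sup>2 * cone_potential u D w"
    unfolding d(1) by simp
qed

lemma continuous_on_hyperbolic_density_ray:
  fixes a u :: complex
  assumes D: "open D" "connected D" and fin: "emeasure lborel D < \<infinity>"
    and ray: "\<And>s. s \<ge> 0 \<Longrightarrow> a + of_real s * u \<in> D" and T: "T \<ge> 0"
  shows "continuous_on {T..t} (\<lambda>s. hyperbolic_density D (a + of_real s * u))"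
proof (rule continuous_at_imp_continuous_on, rule ballI)
  fix s assume "s \<in> {T..t}"
  then have "s \<ge> 0" using T by simp
  have c: "isCont (\<lambda>s. a + of_real s * u) s" by (intro continuous_intros)
  show "isCont (\<lambda>s. hyperbolic_density D (a + of_real s * u)) s"
    by (rule isCont_o2[OF c isCont_hyperbolic_density_finite_area[OF D fin ray[OF \<open>s \<ge> 0\<close>]]])
qed

text \<open>The bound does not depend on \<open>t\<close>: extending the integral of the potential
  to the whole ray beyond \<open>T\<close> costs nothing, because it is at most twice the area of
  the tail.\<close>

lemma inverse_hyperbolic_density_ray_integral:
  fixes a u :: complex
  assumes D: "open D" "connected D" and fin: "emeasure lborel D < \<infinity>"
    and u: "norm u = 1" and ray: "\<And>s. s \<ge> 0 \<Longrightarrow> a + of_real s * u \<in> D" and T: "T \<ge> 0"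
    and tail: "emeasure lborel (D \<inter> {z. T \<le> Re ((z - a) / u) + Im ((z - a) / u)}) \<le> ennreal \<epsilon>" and \<epsilon>: "\<epsilon> \<ge> 0"
  shows "integral {T..t} (\<lambda>s. 1 / hyperbolic_density D (a + of_real s * u))
    \<le> 8 * (newton_const + pi) / (cone_const u)\<^sup>2 * \<epsilon>"
proof -
  define f where "f s = 1 / hyperbolic_density D (a + of_real s * u)" for s
  define K where "K = 4 * (newton_const + pi) / (cone_const u)\<^sup>2"
  have K: "K \<ge> 0" using newton_const_nonneg by (simp add: K_def)
  have pos: "hyperbolic_density D (a + of_real s * u) > 0" if "s \<in> {T..t}" for s
    using hyperbolic_density_pos[OF D fin ray] that T by auto
  have "continuous_on {T..t} (\<lambda>s. hyperbolic_density D (a + of_real s * u))"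
    using continuous_on_hyperbolic_density_ray[OF D fin ray T] .
  then have "continuous_on {T..t} f" unfolding f_def[abs_def]
    by (intro continuous_intros ballI) (assumption, drule pos, simp)
  then have si: "set_integrable lborel {T..t} f" by (rule borel_integrable_atLeastAtMost')
  have nn: "0 \<le> indicator {T..t} s *\<^sub>R f s" for s
    using pos[of s] by (auto simp: f_def indicator_def less_imp_le)
  have "ennreal (integral {T..t} f) = ennreal (LINT s:{T..t}|lborel. f s)"
    using set_borel_integral_eq_integral(2)[OF si] by simp
  also have "\<dots> = (\<integral>\<^sup>+s. ennreal (indicator {T..t} s *\<^sub>R f s) \<partial>lborel)"
    unfolding set_lebesgue_integral_def
    by (rule nn_integral_eq_integral[symmetric]) (use si nn in \<open>auto simp: set_integrable_def\<close>)
  also have "\<dots> \<le> (\<integral>\<^sup>+s. ennreal K * (ennreal (cone_potential u D (a + of_real s * u)) * indicator {T..} s) \<partial>lborel)"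
  proof (rule nn_integral_mono)
    fix s
    show "ennreal (indicator {T..t} s *\<^sub>R f s) \<le> ennreal K * (ennreal (cone_potential u D (a + of_real s * u)) * indicator {T..} s)"
    proof (cases "s \<in> {T..t}")
      case True
      then have "f s \<le> K * cone_potential u D (a + of_real s * u)"
        unfolding f_def K_def using inverse_hyperbolic_density_le[OF D fin ray u] T by auto
      then have "ennreal (f s) \<le> ennreal (K * cone_potential u D (a + of_real s * u))" by (rule ennreal_leI)
      also have "\<dots> = ennreal K * ennreal (cone_potential u D (a + of_real s * u))"
        using K by (rule ennreal_mult')
      finally show ?thesis using True by simp
    qed simp
  qed
  also have "\<dots> \<le> ennreal K * (\<integral>\<^sup>+s. ennreal (cone_potential u D (a + of_real s * u)) * indicator {T..} s \<partial>lborel)"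
  proof (rule eq_refl, rule nn_integral_cmult)
    \<comment> \<open>Measurability of the potential in \<open>s\<close> is obtained by writing it
      as a nonnegative integral depending on a parameter.\<close>
    have [measurable]: "D \<in> sets borel" using D(1) by simp
    have "(\<lambda>s. \<integral>\<^sup>+x. ennreal (cone_kernel u (x - (a + of_real s * u))) * indicator D x \<partial>lborel) \<in> borel_measurable lborel"
      by measurable
    moreover have "ennreal (cone_potential u D (a + of_real s * u)) = (\<integral>\<^sup>+x\<in>D. ennreal (cone_kernel u (x - (a + of_real s * u))) \<partial>lborel)" for s
      unfolding cone_potential_def by (rule ennreal_cone_integral[OF u _ fin]) measurable
    ultimately have [measurable]: "(\<lambda>s. ennreal (cone_potential u D (a + of_real s * u))) \<in> borel_measurable lborel"
      by simp
    show "(\<lambda>s. ennreal (cone_potential u D (a + of_real s * u)) * indicator {T..} s) \<in> borel_measurable lborel"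
      by measurable
  qed
  also have "\<dots> \<le> ennreal K * (2 * ennreal \<epsilon>)"
  proof (rule mult_left_mono)
    show "(\<integral>\<^sup>+s. ennreal (cone_potential u D (a + of_real s * u)) * indicator {T..} s \<partial>lborel) \<le> 2 * ennreal \<epsilon>"
      by (rule order_trans[OF cone_potential_ray_integral[OF u D(1) fin] mult_left_mono[OF tail]]) simp
  qed simp
  also have "\<dots> = ennreal (K * (2 * \<epsilon>))"
  proof -
    have "(2::ennreal) = ennreal 2" by simp
    then show ?thesis using K \<epsilon> by (simp only: ennreal_mult mult_nonneg_nonneg zero_le_numeral)
  qed
  finally have "integral {T..t} f \<le> K * (2 * \<epsilon>)"
    using K \<epsilon> by (subst (asm) ennreal_le_iff) auto
  then show ?thesis by (simp add: K_def f_def[abs_def] mult_ac)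
qed

lemma ray_length_smallo_hyperbolic_length:
  fixes a u :: complex
  assumes D: "open D" "connected D" and fin: "emeasure lborel D < \<infinity>"
    and u: "norm u = 1" and ray: "\<And>s. s \<ge> 0 \<Longrightarrow> a + of_real s * u \<in> D" and c: "c > 0"
  shows "\<forall>\<^sub>F t in at_top. t \<le> c * sqrt (hyperbolic_length D (linepath a (a + of_real t * u)))"
proof -
  define dens where "dens s = hyperbolic_density D (a + of_real s * u)" for s
  define K where "K = 8 * (newton_const + pi) / (cone_const u)\<^sup>2"
  have K: "K > 0" using newton_const_nonneg cone_const_pos[OF u] pi_gt_zero
    by (simp add: K_def add_nonneg_pos)
  \<comment> \<open>For \<open>t \<ge> 2 * T\<close> the remaining length \<open>t - T\<close> is at
    least \<open>t / 2\<close>, so the initial part of the ray is absorbed. The inequality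
    \<open>(t / 2) ^ 2 \<le> H * (K * \<epsilon>)\<close> then reads
    \<open>t ^ 2 \<le> c ^ 2 * H\<close>.\<close>
  define \<epsilon> where "\<epsilon> = c\<^sup>2 / (4 * K)"
  have \<epsilon>: "\<epsilon> > 0" using c K by (simp add: \<epsilon>_def)
  obtain T where T: "T > 0" "emeasure lborel (D \<inter> {z. T \<le> Re ((z - a) / u) + Im ((z - a) / u)}) < ennreal \<epsilon>"
    by (rule emeasure_halfplane_tail[OF D(1) fin \<epsilon>])
  have pos: "dens s > 0" if "s \<ge> 0" for s
    unfolding dens_def by (rule hyperbolic_density_pos[OF D fin ray[OF that]])
  have cont: "continuous_on {r..t} dens" if "r \<ge> 0" for r t
    using continuous_on_hyperbolic_density_ray[OF D fin ray that] unfolding dens_def[abs_def] .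
  have main: "t \<le> c * sqrt (hyperbolic_length D (linepath a (a + of_real t * u)))" if t: "t \<ge> 2 * T" for t
  proof -
    define H where "H = integral {0..t} dens"
    have i0: "dens integrable_on {0..t}" and iT: "dens integrable_on {T..t}"
      using cont T by (auto intro!: integrable_continuous_real)
    have "integral {T..t} dens \<le> H" unfolding H_def
      by (rule integral_subset_le[OF _ iT i0]) (use pos T in \<open>auto simp: less_imp_le\<close>)
    have H: "hyperbolic_length D (linepath a (a + of_real t * u)) = H"
      unfolding H_def dens_def[abs_def]
      by (rule hyperbolic_length_ray_segment[OF u]) (use i0 t T in \<open>auto simp: dens_def[abs_def]\<close>)
    have "(t / 2)\<^sup>2 \<le> (t - T)\<^sup>2" using t T by (intro power_mono) auto
    also have "\<dots> \<le> integral {T..t} dens * integral {T..t} (\<lambda>s. 1 / dens s)"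
      by (rule length_le_sqrt_integrals[OF cont]) (use pos T t in auto)
    also have "\<dots> \<le> H * (K * \<epsilon>)"
    proof (rule mult_mono)
      show "integral {T..t} (\<lambda>s. 1 / dens s) \<le> K * \<epsilon>" unfolding K_def dens_def
        by (rule inverse_hyperbolic_density_ray_integral[OF D fin u ray]) (use T \<epsilon> in auto)
      show "0 \<le> H" unfolding H_def by (rule integral_nonneg[OF i0]) (use pos in \<open>auto simp: less_imp_le\<close>)
      show "0 \<le> integral {T..t} (\<lambda>s. 1 / dens s)"
      proof (rule integral_nonneg)
        have nz: "\<forall>s\<in>{T..t}. dens s \<noteq> 0" using pos T by (auto simp: less_imp_neq[symmetric])
        show "(\<lambda>s. 1 / dens s) integrable_on {T..t}"
          using T by (intro integrable_continuous_real continuous_on_divide continuous_on_const cont nz) simp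
        show "0 \<le> 1 / dens s" if "s \<in> {T..t}" for s using pos[of s] that T by simp
      qed
    qed fact
    also have "\<dots> = (c / 2)\<^sup>2 * H" using K by (simp add: \<epsilon>_def power2_eq_square field_simps)
    finally have "t\<^sup>2 \<le> c\<^sup>2 * H" by (simp add: power_divide)
    then have "sqrt (t\<^sup>2) \<le> sqrt (c\<^sup>2 * H)" by (rule real_sqrt_le_mono)
    then show ?thesis using c t T by (simp add: H real_sqrt_mult)
  qed
  then show ?thesis using eventually_ge_at_top[of "2 * T"] by (rule eventually_mono[rotated])
qed

theorem theorem3p5:
  fixes D :: "complex set" and \<gamma> :: "real \<Rightarrow> complex"
  assumes "open D" and "connected D"
    and "emeasure lebesgue D < \<infinity>"
    and "euclidean_ray_in \<gamma> D"
  shows "(\<lambda>t. euclidean_length (linepath (\<gamma> 0) (\<gamma> t)))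
           \<in> o[at_top](\<lambda>t. hyperbolic_length D (linepath (\<gamma> 0) (\<gamma> t)) powr (1 / 2))"
proof (rule landau_o.smallI)
  fix c :: real assume c: "c > 0"
  obtain a \<phi> where \<gamma>: "\<And>t. t \<ge> 0 \<Longrightarrow> \<gamma> t = a + of_real t * exp (\<i> * of_real \<phi>)"
    and \<gamma>D: "\<And>t. t \<ge> 0 \<Longrightarrow> \<gamma> t \<in> D"
    using assms(4) unfolding euclidean_ray_in_def by blast
  define u where "u = exp (\<i> * of_real \<phi>)"
  have u: "norm u = 1" unfolding u_def by (rule norm_exp_i_times)
  have fin: "emeasure lborel D < \<infinity>" using assms(1,3) by simp
  have ray: "a + of_real s * u \<in> D" if "s \<ge> 0" for s
    using \<gamma>D[OF that] \<gamma>[OF that] by (simp add: u_def)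
  have "\<forall>\<^sub>F t in at_top. t \<le> c * sqrt (hyperbolic_length D (linepath a (a + of_real t * u)))"
    by (rule ray_length_smallo_hyperbolic_length[OF assms(1,2) fin u ray c])
  then show "\<forall>\<^sub>F t in at_top. norm (euclidean_length (linepath (\<gamma> 0) (\<gamma> t)))
      \<le> c * norm (hyperbolic_length D (linepath (\<gamma> 0) (\<gamma> t)) powr (1 / 2))"
    using eventually_gt_at_top[of 0]
  proof eventually_elim
    case (elim t)
    define H where "H = hyperbolic_length D (linepath a (a + of_real t * u))"
    \<comment> \<open>A positive \<open>t\<close> below \<open>c * sqrt H\<close> forces
      \<open>H > 0\<close>, so that \<open>powr (1 / 2)\<close> may be replaced by
      \<open>sqrt\<close> and the norm dropped.\<close>
    have "0 < c * sqrt H" using elim unfolding H_def by linarith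
    then have "H > 0" using c by (simp add: zero_less_mult_iff)
    moreover have "\<gamma> 0 = a" "\<gamma> t = a + of_real t * u" using \<gamma>[of 0] \<gamma>[of t] elim by (simp_all add: u_def)
    ultimately show ?case
      using elim u by (simp add: euclidean_length_linepath norm_mult powr_half_sqrt H_def[symmetric])
  qed
qed

end
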